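(* Let $1\le p<2$ and let $\{a_n;\,n\ge1\}$ be an increasing sequence of positive real numbers such that $\lim_{n\to\infty}a_n=\infty$ and $\{n^{1/p}/a_n;\,n\ge1\}$ is a nondecreasing sequence. Let $(\mathbf{B},\|\cdot\|)$ be a real separable Banach space such that, for every symmetric sequence $\{X,X_n;\,n\ge1\}$ of i.i.d. $\mathbf{B}$-valued random variables, with $S_n=\sum_{i=1}^nX_i$, $$\lim_{n\to\infty}\frac{S_n}{a_n}=0\ \text{ a.s.}\quad\text{if and only if}\quad\sum_{n=1}^\infty\mathbb{P}(\|X\|>a_n)<\infty .$$ Then the Banach space $\mathbf{B}$ is of Rademacher type $p$.
   Context: A $\mathbf{B}$-valued random variable is a Borel measurable map from a probability space into $\mathbf{B}$. A sequence $\{X,X_n;\,n\ge1\}$ of i.i.d. $\mathbf{B}$-valued random variables means that the $X_n$ are independent and each has the same distribution as $X$; it is called symmetric if $X$ and $-X$ have the same distribution. "a.s." means almost surely. "Increasing" means strictly increasing (as opposed to "nondecreasing"). Let $\{R_n;\,n\ge1\}$ be a Rademacher sequence, i.e. i.i.d. real random variables with $\mathbb{P}(R_n=1)=\mathbb{P}(R_n=-1)=1/2$, and let $\mathcal{C}(\mathbf{B})$ be the set of sequences $(v_1,v_2,\ldots)\in\mathbf{B}\times\mathbf{B}\times\cdots$ such that $\sum_{n=1}^\infty R_nv_n$ converges in probability. For $1\le p\le2$, $\mathbf{B}$ is said to be of Rademacher type $p$ if there exists a constant $0<C<\infty$ such that $\mathbb{E}\left\|\sum_{n=1}^\infty R_nv_n\right\|^p\le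 C\sum_{n=1}^\infty\|v_n\|^p$ for all $(v_1,v_2,\ldots)\in\mathcal{C}(\mathbf{B})$. *)

theory Defs
  imports "HOL-Probability.Probability"
begin

text \<open>
  Real separable Banach spaces are types of sort
  \<open>{banach, second_countable_topology}\<close>; for metric spaces, separability and
  second countability coincide.  All sequences are indexed by \<open>n \<ge> 1\<close>; the value
  of a sequence at \<open>0\<close> is irrelevant.
\<close>

definition iid_copies ::
    "'w measure \<Rightarrow> ('w \<Rightarrow> 'b::{banach, second_countable_topology}) \<Rightarrow> (nat \<Rightarrow> 'w \<Rightarrow> 'b) \<Rightarrow> bool"
  where "iid_copies M X Xs \<longleftrightarrow>
    prob_space M \<and> X \<in> borel_measurable M \<and>
    prob_space.indep_vars M (\<lambda>_. borel) Xs {1..} \<and>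
    (\<forall>n\<ge>1. distr M borel (Xs n) = distr M borel X)"

definition symmetric_rv ::
    "'w measure \<Rightarrow> ('w \<Rightarrow> 'b::{banach, second_countable_topology}) \<Rightarrow> bool"
  where "symmetric_rv M X \<longleftrightarrow> distr M borel X = distr M borel (\<lambda>\<omega>. - X \<omega>)"

definition rademacher_seq :: "'r measure \<Rightarrow> (nat \<Rightarrow> 'r \<Rightarrow> real) \<Rightarrow> bool"
  where "rademacher_seq N R \<longleftrightarrow>
    prob_space N \<and> prob_space.indep_vars N (\<lambda>_. borel) R {1..} \<and>
    (\<forall>n\<ge>1. measure N {\<omega> \<in> space N. R n \<omega> = 1} = 1 / 2 \<and>
           measure N {\<omega> \<in> space N. R n \<omega> = - 1} = 1 / 2)"

definition converges_in_prob ::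
    "'w measure \<Rightarrow> (nat \<Rightarrow> 'w \<Rightarrow> 'b::{banach, second_countable_topology}) \<Rightarrow> ('w \<Rightarrow> 'b) \<Rightarrow> bool"
  where "converges_in_prob M Y S \<longleftrightarrow>
    S \<in> borel_measurable M \<and>
    (\<forall>\<epsilon>>0. (\<lambda>n. measure M {\<omega> \<in> space M. norm (Y n \<omega> - S \<omega>) > \<epsilon>}) \<longlonglongrightarrow> 0)"

definition rademacher_sums ::
    "(nat \<Rightarrow> 'r \<Rightarrow> real) \<Rightarrow> (nat \<Rightarrow> 'b) \<Rightarrow> nat \<Rightarrow> 'r \<Rightarrow> 'b::{banach, second_countable_topology}"
  where "rademacher_sums R v n \<omega> = (\<Sum>i=1..n. R i \<omega> *\<^sub>R v i)"

definition rademacher_convergent ::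
    "'r measure \<Rightarrow> (nat \<Rightarrow> 'r \<Rightarrow> real) \<Rightarrow> (nat \<Rightarrow> 'b::{banach, second_countable_topology}) set"
  where "rademacher_convergent N R = {v. \<exists>S. converges_in_prob N (rademacher_sums R v) S}"

text \<open>
  The infinite Rademacher sum is the limit in probability of its partial sums.  It is
  determined only up to null sets, so the inequality is required of every version \<open>S\<close>.
  Both sides are extended nonnegative reals: the right-hand side may be infinite, and
  finiteness of the expectation is part of the claim when it is not.
\<close>

definition rademacher_type ::
    "'r measure \<Rightarrow> (nat \<Rightarrow> 'r \<Rightarrow> real) \<Rightarrow> real \<Rightarrow> 'b::{banach, second_countable_topology} itself \<Rightarrow> bool"
  where "rademacher_type N R p (_ :: 'b itself) \<longleftrightarrow>
    (\<exists>C::real. C > 0 \<and>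
      (\<forall>v \<in> (rademacher_convergent N R :: (nat \<Rightarrow> 'b) set). \<forall>S.
        converges_in_prob N (rademacher_sums R v) S \<longrightarrow>
        (\<integral>\<^sup>+ \<omega>. ennreal (norm (S \<omega>) powr p) \<partial>N)
          \<le> ennreal C * (\<Sum>n. ennreal (norm (v (Suc n)) powr p))))"

text \<open>
  HOL cannot quantify over the type of sample points inside a formula.  In the property
  below the probability space ranges over all probability measures on the type
  \<open>nat \<Rightarrow> 'b\<close>.  Nothing is lost: whether the equivalence holds depends only on
  the law of \<open>X\<close>, and every law on \<open>'b\<close> is the common law of the coordinates of
  an infinite product measure on \<open>nat \<Rightarrow> 'b\<close>.
\<close>

definition symmetric_SLLN_equivalence ::
    "(nat \<Rightarrow> real) \<Rightarrow> 'b::{banach, second_countable_topology} itself \<Rightarrow> bool"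
  where "symmetric_SLLN_equivalence a (_ :: 'b itself) \<longleftrightarrow>
    (\<forall>(M :: (nat \<Rightarrow> 'b) measure) (X :: (nat \<Rightarrow> 'b) \<Rightarrow> 'b) Xs.
      iid_copies M X Xs \<and> symmetric_rv M X \<longrightarrow>
      ((AE \<omega> in M. (\<lambda>n. (\<Sum>i=1..n. Xs i \<omega>) /\<^sub>R a n) \<longlonglongrightarrow> 0) \<longleftrightarrow>
       summable (\<lambda>n. measure M {\<omega> \<in> space M. norm (X \<omega>) > a (Suc n)})))"

end

theory Submission
  imports Defs
begin

text \<open>
  By the Khinchine--Kahane inequality (second moments bound fourth moments, via a two-point
  hypercontractive inequality) and Fatou's lemma, it suffices to bound the second moment of
  \<open>\<Sum>\<^sub>j \<epsilon>\<^sub>j v\<^sub>j\<close> by a constant times \<open>(\<Sum>\<^sub>j \<parallel>v\<^sub>j\<parallel>\<^sup>p)\<close> to the power \<open>2/p\<close> over finite families.  If no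
  constant works, take families \<open>v\<^sub>1, \<dots>, v\<^sub>k\<close> violating the bound by larger and larger factors and
  mix them into one symmetric law: a random family is chosen, then a uniform index \<open>j\<close> and a sign,
  and the value points in direction \<open>v\<^sub>j\<close> with norm \<open>a\<^sub>l\<close>, where \<open>l\<close> is proportional to \<open>\<parallel>v\<^sub>j\<parallel>\<^sup>p\<close>.
  Then \<open>\<Sum> P(\<parallel>X\<parallel> > a\<^sub>n)\<close> converges.  But among \<open>n\<close> draws, with \<open>n\<close> the reciprocal of the probability
  of a single index, each index is hit with probability at least \<open>1/2\<close>; since \<open>n\<^bsup>1/p\<^esup>/a\<^sub>n\<close> is
  nondecreasing, \<open>a\<^sub>l\<close> is large enough for the Rademacher sum over the hit indices to exceed \<open>a\<^sub>n\<close>.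
  Conditioning on everything but the signs and using the Paley--Zygmund inequality, \<open>\<parallel>S\<^sub>n\<parallel> \<ge> a\<^sub>n\<close> with
  probability at least \<open>1/512\<close> for infinitely many \<open>n\<close>, so \<open>S\<^sub>n/a\<^sub>n\<close> does not tend to \<open>0\<close>.
\<close>

section \<open>Rademacher means\<close>

text \<open>\<open>rademacher_mean v J f x\<close> is the expectation of \<open>f (x + \<Sum>\<^bsub>j \<in> J\<^esub> \<epsilon>\<^sub>j v\<^sub>j)\<close> for independent random
  signs \<open>\<epsilon>\<^sub>j\<close>.\<close>

definition rademacher_mean ::
    "('i \<Rightarrow> 'b::real_normed_vector) \<Rightarrow> 'i set \<Rightarrow> ('b \<Rightarrow> real) \<Rightarrow> 'b \<Rightarrow> real"
  where "rademacher_mean v J f =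
    Finite_Set.fold (\<lambda>j F x. (F (x + v j) + F (x - v j)) / 2) f J"

interpretation rademacher_mean: comp_fun_commute
  "\<lambda>j F x. (F (x + v j) + F (x - v j)) / 2 :: real" for v :: "'i \<Rightarrow> 'b::real_normed_vector"
  by standard (simp add: fun_eq_iff add_divide_distrib algebra_simps)

lemma rademacher_mean_empty [simp]: "rademacher_mean v {} f = f"
  by (simp add: rademacher_mean_def)

lemma rademacher_mean_insert [simp]:
  "finite J \<Longrightarrow> j \<notin> J \<Longrightarrow> rademacher_mean v (insert j J) f x =
    (rademacher_mean v J f (x + v j) + rademacher_mean v J f (x - v j)) / 2"
  by (simp add: rademacher_mean_def)

lemma rademacher_mean_cong:
  assumes "finite J" "\<And>j. j \<in> J \<Longrightarrow> v j = w j"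
  shows "rademacher_mean v J f x = rademacher_mean w J f x"
  using assms by (induction J arbitrary: x) auto

lemma rademacher_mean_mono:
  assumes "finite J" "\<And>x. f x \<le> g x"
  shows "rademacher_mean v J f x \<le> rademacher_mean v J g x"
  using assms(1) 
proof (induction J arbitrary: x)
  case (insert j J)
  from insert.IH[of "x + v j"] insert.IH[of "x - v j"] insert.hyps show ?case by simp
qed (use assms in auto)

lemma rademacher_mean_const [simp]:
  "finite J \<Longrightarrow> rademacher_mean v J (\<lambda>_. c) x = c"
  by (induction J arbitrary: x rule: finite_induct) auto

lemma rademacher_mean_add:
  "finite J \<Longrightarrow> rademacher_mean v J (\<lambda>x. f x + g x) x =
    rademacher_mean v J f x + rademacher_mean v J g x"
  by (induction J arbitrary: x rule: finite_induct) (auto simp: field_simps)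

lemma rademacher_mean_cmult:
  "finite J \<Longrightarrow> rademacher_mean v J (\<lambda>x. c * f x) x = c * rademacher_mean v J f x"
  by (induction J arbitrary: x rule: finite_induct) (auto simp: field_simps)

lemma rademacher_mean_nonneg:
  assumes "finite J" "\<And>x. f x \<ge> 0"
  shows "rademacher_mean v J f x \<ge> 0"
  using rademacher_mean_mono[OF assms(1), of "\<lambda>_. 0" f v x] assms by simp

lemma rademacher_mean_scaleR:
  "finite J \<Longrightarrow> rademacher_mean (\<lambda>j. c *\<^sub>R v j) J f (c *\<^sub>R x) =
    rademacher_mean v J (\<lambda>x. f (c *\<^sub>R x)) x"
proof (induction J arbitrary: x rule: finite_induct)
  case (insert j J)
  from insert.IH[of "x + v j"] insert.IH[of "x - v j"] insert.hyps show ?case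
    by (simp add: algebra_simps)
qed auto

lemma rademacher_mean_reindex:
  assumes "finite J" "inj_on h J"
  shows "rademacher_mean v (h ` J) f x = rademacher_mean (v \<circ> h) J f x"
  using assms by (induction J arbitrary: x rule: finite_induct) auto

text \<open>Vectors multiplied by 0 contribute nothing, so passing to a subset is a special choice
  of coefficients. This opens subsets to the contraction principle and to Jensen's
  inequality.\<close>

lemma rademacher_mean_indicator:
  assumes "finite J" "A \<subseteq> J"
  shows "rademacher_mean (\<lambda>j. indicator A j *\<^sub>R v j) J f x = rademacher_mean v A f x"
  using assms
proof (induction J arbitrary: A x rule: finite_induct)
  case (insert j J)
  have fin: "finite (A - {j})" using insert by (meson finite_insert finite_subset finite_Diff)
  \<comment> \<open>\<open>A\<close> may contain \<open>j\<close>, which lies outside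
    \<open>J\<close>. Removing it leaves the family on \<open>J\<close> unchanged and makes the
    induction hypothesis applicable.\<close>
  have eq: "rademacher_mean (\<lambda>j. indicator A j *\<^sub>R v j) J f y = rademacher_mean v (A - {j}) f y" for y
  proof -
    have "rademacher_mean (\<lambda>j. indicator A j *\<^sub>R v j) J f y =
       rademacher_mean (\<lambda>i. indicator (A - {j}) i *\<^sub>R v i) J f y"
      using insert.hyps by (intro rademacher_mean_cong) (auto simp: indicator_def)
    also have "\<dots> = rademacher_mean v (A - {j}) f y"
      using insert.prems by (intro insert.IH) auto
    finally show ?thesis .
  qed
  show ?case
  proof (cases "j \<in> A")
    case True
    then have "A = insert j (A - {j})" by auto
    then have "rademacher_mean v A f x = rademacher_mean v (insert j (A - {j})) f x" by simp
    also have "\<dots> = (rademacher_mean v (A - {j}) f (x + v j) + rademacher_mean v (A - {j}) f (x - v j)) / 2"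
      using fin by (intro rademacher_mean_insert) auto
    finally show ?thesis using True insert.hyps eq by simp
  next
    case False
    then show ?thesis using insert.hyps eq by simp
  qed
qed auto

section \<open>Convexity: Jensen's inequality and the contraction principle\<close>

text \<open>The starting points are averaged with the same weights as the families, so that the
  induction step can replace \<open>x i\<close> by \<open>x i + v i j\<close> and by
  \<open>x i - v i j\<close>.\<close>

lemma rademacher_mean_jensen:
  assumes "finite J" "finite I" "\<And>i. i \<in> I \<Longrightarrow> c i \<ge> 0" "sum c I = 1" "convex_on UNIV f"
  shows "rademacher_mean (\<lambda>j. \<Sum>i\<in>I. c i *\<^sub>R v i j) J f (\<Sum>i\<in>I. c i *\<^sub>R x i)
    \<le> (\<Sum>i\<in>I. c i * rademacher_mean (v i) J f (x i))"
  using assms(1)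
proof (induction J arbitrary: x rule: finite_induct)
  case empty
  have "I \<noteq> {}" using assms(4) by auto
  then show ?case using convex_on_sum[OF assms(2) _ assms(5,4,3)] by simp
next
  case (insert j J)
  have "rademacher_mean (\<lambda>j. \<Sum>i\<in>I. c i *\<^sub>R v i j) (insert j J) f (\<Sum>i\<in>I. c i *\<^sub>R x i) =
     (rademacher_mean (\<lambda>j. \<Sum>i\<in>I. c i *\<^sub>R v i j) J f (\<Sum>i\<in>I. c i *\<^sub>R (x i + v i j))
     + rademacher_mean (\<lambda>j. \<Sum>i\<in>I. c i *\<^sub>R v i j) J f (\<Sum>i\<in>I. c i *\<^sub>R (x i - v i j))) / 2"
    using insert.hyps by (simp add: algebra_simps sum.distrib sum_subtractf)
  also have "\<dots> \<le> ((\<Sum>i\<in>I. c i * rademacher_mean (v i) J f (x i + v i j))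
     + (\<Sum>i\<in>I. c i * rademacher_mean (v i) J f (x i - v i j))) / 2"
    using insert.IH[of "\<lambda>i. x i + v i j"] insert.IH[of "\<lambda>i. x i - v i j"] by simp
  also have "\<dots> = (\<Sum>i\<in>I. c i * rademacher_mean (v i) (insert j J) f (x i))"
    using insert.hyps by (simp add: sum.distrib[symmetric] sum_divide_distrib algebra_simps add_divide_distrib)
  finally show ?case .
qed

lemma convex_on_rademacher_mean:
  assumes "finite J" "convex_on UNIV f"
  shows "convex_on UNIV (rademacher_mean v J f)"
proof (rule convex_onI)
  fix t :: real and x y
  assume t: "0 < t" "t < 1"
  have "rademacher_mean (\<lambda>j. \<Sum>b\<in>UNIV. (if b then t else 1 - t) *\<^sub>R v j) J f
      (\<Sum>b\<in>UNIV. (if b then t else 1 - t) *\<^sub>R (if b then y else x))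
    \<le> (\<Sum>b\<in>UNIV. (if b then t else 1 - t) * rademacher_mean v J f (if b then y else x))"
    using t assms by (intro rademacher_mean_jensen) (auto simp: UNIV_bool)
  then show "rademacher_mean v J f ((1 - t) *\<^sub>R x + t *\<^sub>R y)
    \<le> (1 - t) * rademacher_mean v J f x + t * rademacher_mean v J f y"
    by (simp add: UNIV_bool scaleR_add_left[symmetric])
qed auto

text \<open>Both inner points lie on the segment from \<open>x - w\<close> to \<open>x + w\<close>,
  symmetric about its midpoint. There the chord lies above \<open>f\<close>, and being affine it has
  the same sum over either symmetric pair.\<close>

lemma convex_on_symmetric_pair:
  fixes f :: "'b::real_vector \<Rightarrow> real"
  assumes "convex_on UNIV f" "\<bar>b\<bar> \<le> 1"
  shows "f (x + b *\<^sub>R w) + f (x - b *\<^sub>R w) \<le> f (x + w) + f (x - w)"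
proof -
  have *: "f (x + c *\<^sub>R w) \<le> (1 - (1 + c) / 2) * f (x - w) + (1 + c) / 2 * f (x + w)"
    if "\<bar>c\<bar> \<le> 1" for c
  proof -
    have "f ((1 - (1 + c) / 2) *\<^sub>R (x - w) + ((1 + c) / 2) *\<^sub>R (x + w)) \<le>
      (1 - (1 + c) / 2) * f (x - w) + (1 + c) / 2 * f (x + w)"
      using that by (intro convex_onD[OF assms(1)]) auto
    moreover have "(1 - (1 + c) / 2) *\<^sub>R (x - w) + ((1 + c) / 2) *\<^sub>R (x + w) = x + c *\<^sub>R w"
    proof -
      have "(1 - (1 + c) / 2) *\<^sub>R (x - w) + ((1 + c) / 2) *\<^sub>R (x + w)
         = ((1 - (1 + c) / 2) + (1 + c) / 2) *\<^sub>R x + ((1 + c) / 2 - (1 - (1 + c) / 2)) *\<^sub>R w"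
        by (simp only: scaleR_add_left scaleR_diff_left scaleR_diff_right scaleR_add_right) (simp add: algebra_simps)
      also have "\<dots> = x + c *\<^sub>R w" by (simp add: field_simps)
      finally show ?thesis .
    qed
    ultimately show ?thesis by simp
  qed
  from *[of b] *[of "-b"] assms(2) show ?thesis by (simp add: field_simps)
qed

text \<open>One sign at a time: the mean over the remaining signs is convex in the starting point,
  so the two-point case applies to it.\<close>

lemma rademacher_mean_contraction:
  assumes "finite J" "convex_on UNIV f" "\<And>j. j \<in> J \<Longrightarrow> \<bar>b j\<bar> \<le> 1"
  shows "rademacher_mean (\<lambda>j. b j *\<^sub>R v j) J f x \<le> rademacher_mean v J f x"
  using assms(1,3)
proof (induction J arbitrary: x rule: finite_induct)
  case (insert j J)
  have "rademacher_mean (\<lambda>j. b j *\<^sub>R v j) (insert j J) f x \<le>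
    (rademacher_mean v J f (x + b j *\<^sub>R v j) + rademacher_mean v J f (x - b j *\<^sub>R v j)) / 2"
    unfolding rademacher_mean_insert[OF insert.hyps]
    by (intro divide_right_mono add_mono insert.IH) (use insert.prems in auto)
  also have "\<dots> \<le> rademacher_mean v (insert j J) f x"
    using convex_on_symmetric_pair[OF convex_on_rademacher_mean[OF insert.hyps(1) assms(2)], of "b j" v x "v j"]
      insert by simp
  finally show ?case .
qed auto

lemma rademacher_mean_subset:
  assumes "finite J" "A \<subseteq> J" "convex_on UNIV f"
  shows "rademacher_mean v A f x \<le> rademacher_mean v J f x"
  unfolding rademacher_mean_indicator[OF assms(1,2), symmetric]
  by (rule rademacher_mean_contraction[OF assms(1,3)]) (simp add: indicator_def)

lemma convex_on_norm_square: "convex_on UNIV (\<lambda>x::'b::real_normed_vector. (norm x)\<^sup>2)"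
proof (rule convex_onI)
  fix t :: real and x y :: 'b
  assume t: "0 < t" "t < 1"
  have "(norm ((1 - t) *\<^sub>R x + t *\<^sub>R y))\<^sup>2 \<le> ((1 - t) * norm x + t * norm y)\<^sup>2"
    using t norm_triangle_ineq[of "(1 - t) *\<^sub>R x" "t *\<^sub>R y"] by (intro power_mono) auto
  also have "\<dots> = (1 - t) * (norm x)\<^sup>2 + t * (norm y)\<^sup>2 - t * (1 - t) * (norm x - norm y)\<^sup>2"
    by algebra
  also have "\<dots> \<le> (1 - t) * (norm x)\<^sup>2 + t * (norm y)\<^sup>2"
    using t by simp
  finally show "(norm ((1 - t) *\<^sub>R x + t *\<^sub>R y))\<^sup>2 \<le> (1 - t) * (norm x)\<^sup>2 + t * (norm y)\<^sup>2" .
qed auto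

section \<open>Hypercontractivity and the Paley-Zygmund inequality\<close>

text \<open>The hypercontractive estimate for a single sign. The points \<open>x + w/2\<close> and
  \<open>x - w/2\<close> are convex combinations of \<open>x + w\<close> and \<open>x - w\<close>
  with weights 3/4 and 1/4, so the triangle inequality reduces the claim to two real
  numbers.\<close>

lemma two_point_inequality:
  fixes x w :: "'b::real_normed_vector"
  shows "(norm (x + (1/2) *\<^sub>R w)) ^ 4 + (norm (x - (1/2) *\<^sub>R w)) ^ 4
    \<le> 2 * (((norm (x + w))\<^sup>2 + (norm (x - w))\<^sup>2) / 2)\<^sup>2"
proof -
  define P Q where "P = norm (x + w)" and "Q = norm (x - w)"
  have *: "norm (x + c *\<^sub>R w) \<le> (1 + c) / 2 * P + (1 - c) / 2 * Q" if "c = 1/2 \<or> c = -1/2" for c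
  proof -
    have "x + c *\<^sub>R w = ((1 + c) / 2) *\<^sub>R (x + w) + ((1 - c) / 2) *\<^sub>R (x - w)"
    proof -
      have "((1 + c) / 2) *\<^sub>R (x + w) + ((1 - c) / 2) *\<^sub>R (x - w)
         = ((1 + c) / 2 + (1 - c) / 2) *\<^sub>R x + ((1 + c) / 2 - (1 - c) / 2) *\<^sub>R w"
        by (simp only: scaleR_add_left scaleR_diff_left scaleR_diff_right scaleR_add_right) (simp add: algebra_simps)
      also have "\<dots> = x + c *\<^sub>R w" by (simp add: field_simps)
      finally show ?thesis by simp
    qed
    then show ?thesis
      using that norm_triangle_ineq[of "((1 + c) / 2) *\<^sub>R (x + w)" "((1 - c) / 2) *\<^sub>R (x - w)"]
      by (auto simp: P_def Q_def)
  qed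
  have "norm (x + (1/2) *\<^sub>R w) ^ 4 \<le> (3/4 * P + 1/4 * Q) ^ 4"
    using *[of "1/2"] by (intro power_mono) auto
  moreover have "norm (x - (1/2) *\<^sub>R w) ^ 4 \<le> (1/4 * P + 3/4 * Q) ^ 4"
    using *[of "-1/2"] by (intro power_mono) auto
  moreover have "(3/4 * P + 1/4 * Q) ^ 4 + (1/4 * P + 3/4 * Q) ^ 4 \<le> 2 * ((P\<^sup>2 + Q\<^sup>2) / 2)\<^sup>2"
  proof -
    \<comment> \<open>In these coordinates the odd powers of \<open>B\<close> cancel between the two
      fourth powers, and the gap has nonnegative coefficients only.\<close>
    define A B where "A = (P + Q) / 2" and "B = (P - Q) / 4"
    have e: "(P\<^sup>2 + Q\<^sup>2) / 2 = A\<^sup>2 + 4 * B\<^sup>2" "3/4 * P + 1/4 * Q = A + B"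
        "1/4 * P + 3/4 * Q = A - B"
      by (simp_all add: A_def B_def power2_eq_square field_simps)
    have "2 * (A\<^sup>2 + 4 * B\<^sup>2)\<^sup>2 - ((A + B) ^ 4 + (A - B) ^ 4) = 4 * (A\<^sup>2 * B\<^sup>2) + 30 * B ^ 4"
      by algebra
    moreover have "\<dots> \<ge> 0" by simp
    ultimately show ?thesis unfolding e by linarith
  qed
  ultimately show ?thesis unfolding P_def Q_def by linarith
qed

text \<open>Minkowski's inequality in \<open>L\<^sup>2\<close> of a two-point space: the premises survive averaging, so the
  two-point inequality tensorises.\<close>

lemma minkowski_two_point:
  fixes a b c d A B :: real
  assumes "a\<^sup>2 + b\<^sup>2 \<le> 2 * A\<^sup>2" "c\<^sup>2 + d\<^sup>2 \<le> 2 * B\<^sup>2" "A \<ge> 0" "B \<ge> 0"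
  shows "((a + c) / 2)\<^sup>2 + ((b + d) / 2)\<^sup>2 \<le> 2 * ((A + B) / 2)\<^sup>2"
proof -
  have "(a * c + b * d)\<^sup>2 \<le> (a\<^sup>2 + b\<^sup>2) * (c\<^sup>2 + d\<^sup>2)"
  proof -
    have "(a\<^sup>2 + b\<^sup>2) * (c\<^sup>2 + d\<^sup>2) - (a * c + b * d)\<^sup>2 = (a * d - b * c)\<^sup>2" by algebra
    then show ?thesis by (smt (verit) zero_le_power2)
  qed
  also have "\<dots> \<le> (2 * A\<^sup>2) * (2 * B\<^sup>2)" using assms by (intro mult_mono) auto
  also have "\<dots> = (2 * A * B)\<^sup>2" by algebra
  finally have "a * c + b * d \<le> 2 * A * B"
    by (rule power2_le_imp_le) (use assms in simp)
  moreover have "((a + c) / 2)\<^sup>2 + ((b + d) / 2)\<^sup>2 = ((a\<^sup>2 + b\<^sup>2) + (c\<^sup>2 + d\<^sup>2) + 2 * (a * c + b * d)) / 4"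
    by (simp add: power2_eq_square field_simps)
  moreover have "2 * ((A + B) / 2)\<^sup>2 = (2 * A\<^sup>2 + 2 * B\<^sup>2 + 2 * (2 * A * B)) / 4"
    by (simp add: power2_eq_square field_simps)
  ultimately show ?thesis using assms by simp
qed

text \<open>The two-point inequality survives averaging: adding a sign averages the instances at
  \<open>x + v j\<close> and \<open>x - v j\<close>, and Minkowski's inequality combines
  them.\<close>

lemma rademacher_mean_square_two_point:
  fixes v :: "'i \<Rightarrow> 'b::real_normed_vector"
  assumes "finite J"
  defines "G \<equiv> rademacher_mean v J (\<lambda>x. (norm x)\<^sup>2)"
  shows "(G (x + (1/2) *\<^sub>R w))\<^sup>2 + (G (x - (1/2) *\<^sub>R w))\<^sup>2 \<le> 2 * ((G (x + w) + G (x - w)) / 2)\<^sup>2"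
  unfolding G_def using assms(1)
proof (induction J arbitrary: x rule: finite_induct)
  case empty
  have "((norm z)\<^sup>2)\<^sup>2 = norm z ^ 4" for z :: 'b by simp
  then show ?case using two_point_inequality[of x w] by (simp only: rademacher_mean_empty)
next
  case (insert j J)
  let ?G = "rademacher_mean v J (\<lambda>x. (norm x)\<^sup>2)"
  have nn: "?G y \<ge> 0" for y using insert.hyps by (intro rademacher_mean_nonneg) auto
  have shift: "x + v j + u = x + u + v j" "x - v j + u = x + u - v j"
    "x + v j - u = x - u + v j" "x - v j - u = x - u - v j" for u
    by auto
  have "((?G (x + (1/2) *\<^sub>R w + v j) + ?G (x + (1/2) *\<^sub>R w - v j)) / 2)\<^sup>2 +
      ((?G (x - (1/2) *\<^sub>R w + v j) + ?G (x - (1/2) *\<^sub>R w - v j)) / 2)\<^sup>2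
    \<le> 2 * (((?G (x + w + v j) + ?G (x - w + v j)) / 2 + (?G (x + w - v j) + ?G (x - w - v j)) / 2) / 2)\<^sup>2"
    by (rule minkowski_two_point[OF insert.IH[of "x + v j", unfolded shift]
          insert.IH[of "x - v j", unfolded shift]])
      (simp_all add: nn)
  also have "(?G (x + w + v j) + ?G (x - w + v j)) / 2 + (?G (x + w - v j) + ?G (x - w - v j)) / 2 =
      (?G (x + w + v j) + ?G (x + w - v j)) / 2 + (?G (x - w + v j) + ?G (x - w - v j)) / 2"
    by (simp add: add_divide_distrib)
  finally show ?case unfolding rademacher_mean_insert[OF insert.hyps] .
qed

text \<open>The induction hypothesis removes the factor 1/2 from the signs in \<open>J\<close>,
  leaving squares of second-moment means; the two-point inequality for these means removes it from
  the last sign.\<close>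

lemma rademacher_mean_hypercontractive:
  assumes "finite J"
  shows "rademacher_mean (\<lambda>j. (1/2) *\<^sub>R v j) J (\<lambda>x. norm x ^ 4) x
    \<le> (rademacher_mean v J (\<lambda>x. (norm x)\<^sup>2) x)\<^sup>2"
  using assms
proof (induction J arbitrary: x rule: finite_induct)
  case empty
  then show ?case by simp
next
  case (insert j J)
  let ?G = "rademacher_mean v J (\<lambda>x. (norm x)\<^sup>2)"
  have "rademacher_mean (\<lambda>j. (1/2) *\<^sub>R v j) (insert j J) (\<lambda>x. norm x ^ 4) x
    \<le> ((?G (x + (1/2) *\<^sub>R v j))\<^sup>2 + (?G (x - (1/2) *\<^sub>R v j))\<^sup>2) / 2"
    unfolding rademacher_mean_insert[OF insert.hyps]
    by (intro divide_right_mono add_mono insert.IH) auto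
  also have "\<dots> \<le> ((?G (x + v j) + ?G (x - v j)) / 2)\<^sup>2"
  proof -
    have "p / 2 \<le> q" if "p \<le> 2 * q" for p q :: real
      using that by simp
    then show ?thesis using rademacher_mean_square_two_point[OF insert.hyps(1)] .
  qed
  also have "\<dots> = (rademacher_mean v (insert j J) (\<lambda>x. (norm x)\<^sup>2) x)\<^sup>2"
    using insert.hyps by simp
  finally show ?case .
qed

text \<open>By homogeneity, undoing the factor 1/2 costs \<open>2^4 = 16\<close>.\<close>

lemma rademacher_mean_fourth_moment:
  assumes "finite J"
  shows "rademacher_mean v J (\<lambda>x. norm x ^ 4) 0
    \<le> 16 * (rademacher_mean v J (\<lambda>x. (norm x)\<^sup>2) 0)\<^sup>2"
proof -
  have "rademacher_mean (\<lambda>j. (1/2) *\<^sub>R v j) J (\<lambda>x. norm x ^ 4) 0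
    = rademacher_mean v J (\<lambda>x. (1/16) * norm x ^ 4) 0"
    using rademacher_mean_scaleR[OF assms, of "1/2" v "\<lambda>x. norm x ^ 4" 0] by (simp add: power_divide)
  also have "\<dots> = (1/16) * rademacher_mean v J (\<lambda>x. norm x ^ 4) 0"
    by (rule rademacher_mean_cmult[OF assms])
  finally show ?thesis using rademacher_mean_hypercontractive[OF assms, of v 0] by simp
qed

text \<open>A pointwise bound takes the place of the Cauchy-Schwarz inequality, so that monotonicity
  and linearity of the mean suffice beside the fourth-moment bound.\<close>

lemma rademacher_mean_paley_zygmund:
  fixes v :: "'i \<Rightarrow> 'b::real_normed_vector"
  assumes "finite J"
  defines "F \<equiv> rademacher_mean v J (\<lambda>x. (norm x)\<^sup>2) 0"
  assumes "F > 0"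
  shows "rademacher_mean v J (indicator {x. (norm x)\<^sup>2 \<ge> F / 2}) 0 \<ge> 1 / 64"
proof -
  let ?I = "indicator {x. (norm x)\<^sup>2 \<ge> F / 2}"
  \<comment> \<open>With \<open>y = (norm x)^2\<close>, the event uses
    \<open>y <= y^2 / (64 * F) + 16 * F\<close>, and its complement \<open>y < F / 2\<close>. The
    weight turns the fourth-moment bound \<open>16 * F^2\<close> into \<open>F / 4\<close>, which
    leaves a quarter of \<open>F\<close> for the event.\<close>
  have pt: "(norm x)\<^sup>2 \<le> F / 2 + (1 / (64 * F) * norm x ^ 4 + 16 * F * ?I x)" for x :: 'b
  proof (cases "(norm x)\<^sup>2 \<ge> F / 2")
    case True
    have "0 \<le> ((norm x)\<^sup>2 - 32 * F)\<^sup>2 / (64 * F)" using \<open>F > 0\<close> by simp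
    also have "\<dots> = 1 / (64 * F) * norm x ^ 4 + 16 * F - (norm x)\<^sup>2"
      using \<open>F > 0\<close> by (simp add: field_simps power2_eq_square power4_eq_xxxx)
    finally show ?thesis using True \<open>F > 0\<close> by (auto simp: indicator_def)
  next
    case False
    then show ?thesis using \<open>F > 0\<close> by (auto intro!: add_increasing2)
  qed
  have "F \<le> rademacher_mean v J (\<lambda>x. F / 2 + (1 / (64 * F) * norm x ^ 4 + 16 * F * ?I x)) 0"
    unfolding F_def by (rule rademacher_mean_mono[OF assms(1)]) (use pt in \<open>simp add: F_def\<close>)
  also have "\<dots> = F / 2 + (1 / (64 * F) * rademacher_mean v J (\<lambda>x. norm x ^ 4) 0
      + 16 * F * rademacher_mean v J ?I 0)"
    by (simp only: rademacher_mean_add rademacher_mean_cmult rademacher_mean_const assms(1))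
  also have "\<dots> \<le> F / 2 + (1 / (64 * F) * (16 * F\<^sup>2) + 16 * F * rademacher_mean v J ?I 0)"
    using rademacher_mean_fourth_moment[OF assms(1), of v] \<open>F > 0\<close>
    unfolding F_def by (intro add_mono mult_left_mono order_refl) auto
  also have "\<dots> = F * (3/4 + 16 * rademacher_mean v J ?I 0)"
  proof -
    have "F / 2 + (1 / (64 * F) * (16 * F\<^sup>2) + 16 * F * R) = F * (3/4 + 16 * R)" for R
      using \<open>F > 0\<close> by (simp add: field_simps power2_eq_square)
    then show ?thesis .
  qed
  finally have "F * 1 \<le> F * (3/4 + 16 * rademacher_mean v J ?I 0)" by simp
  then have "1 \<le> 3/4 + 16 * rademacher_mean v J ?I 0"
    using \<open>F > 0\<close> by (rule mult_left_le_imp_le)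
  then show ?thesis by simp
qed

section \<open>Sums of independent symmetric variables\<close>

text \<open>The preimage of a cylinder is a cylinder, and cylinders determine a product measure.
  This serves both to flip one coordinate and to pass from random indices to random vectors.\<close>

lemma distr_PiM_UNIV:
  fixes M :: "'i \<Rightarrow> 'a measure"
  assumes M: "\<And>i. prob_space (M i)" and \<phi>[measurable]: "\<And>i. \<phi> i \<in> M i \<rightarrow>\<^sub>M N i"
  shows "distr (PiM UNIV M) (PiM UNIV N) (\<lambda>\<omega> i. \<phi> i (\<omega> i)) =
    PiM UNIV (\<lambda>i. distr (M i) (N i) (\<phi> i))"
proof -
  interpret Q: prob_space "distr (M i) (N i) (\<phi> i)" for i
    by (rule prob_space.prob_space_distr) (use M \<phi> in auto)
  interpret Q: product_prob_space "\<lambda>i. distr (M i) (N i) (\<phi> i)" UNIV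
    by unfold_locales
  have meas: "(\<lambda>\<omega> i. \<phi> i (\<omega> i)) \<in> PiM UNIV M \<rightarrow>\<^sub>M PiM UNIV N"
    by (rule measurable_PiM_single') (use measurable_space[OF \<phi>] in \<open>auto simp: space_PiM PiE_iff\<close>)
  show ?thesis
  proof (rule Q.PiM_eq)
    show "sets (distr (PiM UNIV M) (PiM UNIV N) (\<lambda>\<omega> i. \<phi> i (\<omega> i))) =
      sets (PiM UNIV (\<lambda>i. distr (M i) (N i) (\<phi> i)))"
      by (simp cong: sets_PiM_cong)
    fix J :: "'i set" and F
    assume J: "finite J" "J \<subseteq> UNIV" and F: "\<And>j. j \<in> J \<Longrightarrow> F j \<in> sets (distr (M j) (N j) (\<phi> j))"
    let ?E = "prod_emb UNIV (\<lambda>i. distr (M i) (N i) (\<phi> i)) J (Pi\<^sub>E J F)"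
    have sets: "?E \<in> sets (PiM UNIV N)"
    proof -
      have "?E \<in> sets (PiM UNIV (\<lambda>i. distr (M i) (N i) (\<phi> i)))"
        using J F by (intro sets_PiM_I) auto
      then show ?thesis by (simp cong: sets_PiM_cong)
    qed
    have "emeasure (distr (PiM UNIV M) (PiM UNIV N) (\<lambda>\<omega> i. \<phi> i (\<omega> i))) ?E =
      emeasure (PiM UNIV M) ((\<lambda>\<omega> i. \<phi> i (\<omega> i)) -` ?E \<inter> space (PiM UNIV M))"
      by (rule emeasure_distr[OF meas sets])
    also have "(\<lambda>\<omega> i. \<phi> i (\<omega> i)) -` ?E \<inter> space (PiM UNIV M) =
      prod_emb UNIV M J (\<Pi>\<^sub>E j\<in>J. \<phi> j -` F j \<inter> space (M j))"
      by (auto simp: prod_emb_def space_PiM PiE_iff measurable_space[OF \<phi>])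
    also have "emeasure (PiM UNIV M) \<dots> = (\<Prod>j\<in>J. emeasure (M j) (\<phi> j -` F j \<inter> space (M j)))"
      using J F by (intro emeasure_PiM_emb M) auto
    also have "\<dots> = (\<Prod>j\<in>J. emeasure (distr (M j) (N j) (\<phi> j)) (F j))"
      using F by (intro prod.cong refl emeasure_distr[symmetric]) auto
    finally show "emeasure (distr (PiM UNIV M) (PiM UNIV N) (\<lambda>\<omega> i. \<phi> i (\<omega> i))) ?E =
      (\<Prod>j\<in>J. emeasure (distr (M j) (N j) (\<phi> j)) (F j))" .
  qed
qed

lemma borel_measurable_rademacher_mean:
  fixes v :: "'a \<Rightarrow> 'i \<Rightarrow> 'b::{real_normed_vector, second_countable_topology}"
  assumes "finite J" "\<And>i. i \<in> J \<Longrightarrow> (\<lambda>\<omega>. v \<omega> i) \<in> borel_measurable M"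
    and [measurable]: "f \<in> borel_measurable borel" and "x \<in> borel_measurable M"
  shows "(\<lambda>\<omega>. rademacher_mean (v \<omega>) J f (x \<omega>)) \<in> borel_measurable M"
  using assms(1,2,4)
proof (induction J arbitrary: x rule: finite_induct)
  case empty
  then have [measurable]: "x \<in> borel_measurable M" by auto
  show ?case by simp
next
  case (insert j J)
  have [measurable]: "x \<in> borel_measurable M" "(\<lambda>\<omega>. v \<omega> j) \<in> borel_measurable M"
    using insert.prems by auto
  have [measurable]: "(\<lambda>\<omega>. rademacher_mean (v \<omega>) J f (x \<omega> + v \<omega> j)) \<in> borel_measurable M"
     "(\<lambda>\<omega>. rademacher_mean (v \<omega>) J f (x \<omega> - v \<omega> j)) \<in> borel_measurable M"
    by (rule insert.IH; use insert.prems in simp)+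
  show ?case using insert.hyps by simp
qed

lemma ennreal_average: "a \<ge> 0 \<Longrightarrow> b \<ge> 0 \<Longrightarrow> ennreal ((a + b) / 2) = (ennreal a + ennreal b) / 2"
  by (simp add: ennreal_plus[symmetric] divide_ennreal[symmetric] del: ennreal_plus)

lemma ennreal_average_same: "(c + c) / 2 = (c::ennreal)"
  using ennreal_mult_divide_eq[of 2 c] by (simp add: mult_2_right)

section \<open>Fresh signs for independent symmetric draws\<close>

text \<open>Symmetry is given by a measure-preserving map of the index space rather than by an
  equality of laws, so that the sign can be flipped in one coordinate of a sample.\<close>

locale symmetric_index =
  fixes \<mu> :: "'a pmf" and flip :: "'a \<Rightarrow> 'a"
    and g :: "'a \<Rightarrow> 'b::{banach, second_countable_topology}"
  assumes map_flip: "map_pmf flip \<mu> = \<mu>" and g_flip: "\<And>z. g (flip z) = - g z"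
begin

definition P :: "(nat \<Rightarrow> 'a) measure" where "P = PiM UNIV (\<lambda>_. measure_pmf \<mu>)"

sublocale P: prob_space P
  unfolding P_def by (rule prob_space_PiM) (rule prob_space_measure_pmf)

lemma measurable_component: "(\<lambda>\<omega>. h (\<omega> i)) \<in> P \<rightarrow>\<^sub>M M" if "range h \<subseteq> space M"
proof -
  have "(\<lambda>\<omega>. \<omega> i) \<in> P \<rightarrow>\<^sub>M measure_pmf \<mu>"
    unfolding P_def by (rule measurable_component_singleton) auto
  moreover have "h \<in> measure_pmf \<mu> \<rightarrow>\<^sub>M M" using that by (auto simp: measurable_def)
  ultimately show ?thesis by (rule measurable_compose)
qed

lemma borel_measurable_component:
  "(\<lambda>\<omega>. h (\<omega> i)) \<in> borel_measurable P" for h :: "'a \<Rightarrow> 'c::topological_space"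
  by (rule measurable_component) auto

lemma distr_flip_component:
  "distr P P (\<lambda>\<omega> i. if i = j then flip (\<omega> i) else \<omega> i) = P"
proof -
  have "distr P P (\<lambda>\<omega> i. (if i = j then flip else id) (\<omega> i)) =
    PiM UNIV (\<lambda>i. distr (measure_pmf \<mu>) (measure_pmf \<mu>) (if i = j then flip else id))"
    unfolding P_def by (rule distr_PiM_UNIV) (auto simp: prob_space_measure_pmf)
  also have "\<dots> = P"
    unfolding P_def
  proof (rule PiM_cong)
    fix i
    have "distr (measure_pmf \<mu>) (measure_pmf \<mu>) (if i = j then flip else id) =
       distr (measure_pmf \<mu>) (count_space UNIV) (if i = j then flip else id)"
      by (rule distr_cong) auto
    also have "\<dots> = measure_pmf (map_pmf (if i = j then flip else id) \<mu>)"
      by (rule map_pmf_rep_eq[symmetric])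
    finally show "distr (measure_pmf \<mu>) (measure_pmf \<mu>) (if i = j then flip else id) = measure_pmf \<mu>"
      by (simp add: map_flip id_def)
  qed simp
  finally show ?thesis by (simp add: if_distrib[of "\<lambda>f. f _"] cong: if_cong)
qed

lemma nn_integral_flip_component:
  assumes "f \<in> borel_measurable P"
  shows "(\<integral>\<^sup>+\<omega>. f (\<lambda>i. if i = j then flip (\<omega> i) else \<omega> i) \<partial>P) = (\<integral>\<^sup>+\<omega>. f \<omega> \<partial>P)"
proof -
  have meas: "(\<lambda>\<omega> i. if i = j then flip (\<omega> i) else \<omega> i) \<in> P \<rightarrow>\<^sub>M P"
  proof -
    have "(\<lambda>\<omega> i. if i = j then flip (\<omega> i) else \<omega> i) \<in> P \<rightarrow>\<^sub>M PiM UNIV (\<lambda>_. measure_pmf \<mu>)"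
    proof (rule measurable_PiM_single')
      fix i
      show "(\<lambda>\<omega>. if i = j then flip (\<omega> i) else \<omega> i) \<in> P \<rightarrow>\<^sub>M measure_pmf \<mu>"
        using measurable_component[of "if i = j then flip else id" "measure_pmf \<mu>" i] by (cases "i = j") auto
    qed (auto simp: space_PiM)
    then show ?thesis by (simp add: P_def)
  qed
  have "(\<integral>\<^sup>+\<omega>. f \<omega> \<partial>P) = (\<integral>\<^sup>+\<omega>. f \<omega> \<partial>distr P P (\<lambda>\<omega> i. if i = j then flip (\<omega> i) else \<omega> i))"
    by (simp add: distr_flip_component)
  also have "\<dots> = (\<integral>\<^sup>+\<omega>. f (\<lambda>i. if i = j then flip (\<omega> i) else \<omega> i) \<partial>P)"
    by (rule nn_integral_distr[OF meas]) (use assms in simp)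
  finally show ?thesis by simp
qed

text \<open>Coordinates in \<open>J\<close> receive fresh signs, those in \<open>K\<close> keep the
  sampled ones. For a new \<open>j\<close> the induction hypothesis is used with \<open>j\<close>
  moved into \<open>K\<close>; as flipping coordinate \<open>j\<close> preserves \<open>P\<close>,
  the shifts by \<open>g (\<omega> j)\<close> and by its negative have the same integral.\<close>

lemma nn_integral_sum_eq_rademacher_mean_aux:
  assumes "finite J" "finite K" "J \<inter> K = {}"
    and f[measurable]: "f \<in> borel_measurable borel" and nn: "\<And>x. f x \<ge> 0"
  shows "(\<integral>\<^sup>+\<omega>. ennreal (f (\<Sum>i\<in>J \<union> K. g (\<omega> i))) \<partial>P) =
    (\<integral>\<^sup>+\<omega>. ennreal (rademacher_mean (\<lambda>i. g (\<omega> i)) J f (\<Sum>i\<in>K. g (\<omega> i))) \<partial>P)"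
  using assms(1-3)
proof (induction J arbitrary: K rule: finite_induct)
  case (insert j J)
  note [measurable] = borel_measurable_component[of g]
  have [measurable]: "(\<lambda>\<omega>. rademacher_mean (\<lambda>i. g (\<omega> i)) J f (x \<omega>)) \<in> borel_measurable P"
    if "x \<in> borel_measurable P" for x
    using insert.hyps that by (intro borel_measurable_rademacher_mean f) auto
  let ?R = "\<lambda>\<omega>. rademacher_mean (\<lambda>i. g (\<omega> i)) J f"
  let ?S = "\<lambda>\<omega>. \<Sum>i\<in>K. g (\<omega> i)"
  define I where "I = (\<integral>\<^sup>+\<omega>. ennreal (f (\<Sum>i\<in>insert j J \<union> K. g (\<omega> i))) \<partial>P)"
  have nnR: "?R \<omega> x \<ge> 0" for \<omega> x using insert.hyps nn by (intro rademacher_mean_nonneg) auto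
  have "j \<notin> K" using insert.prems by auto
  have "I = (\<integral>\<^sup>+\<omega>. ennreal (?R \<omega> (\<Sum>i\<in>insert j K. g (\<omega> i))) \<partial>P)"
    unfolding I_def using insert.IH[of "insert j K"] insert.prems insert.hyps by auto
  then have 1: "I = (\<integral>\<^sup>+\<omega>. ennreal (?R \<omega> (?S \<omega> + g (\<omega> j))) \<partial>P)"
    using insert.prems \<open>j \<notin> K\<close> by (simp add: add.commute)
  also have "\<dots> = (\<integral>\<^sup>+\<omega>. ennreal (?R (\<lambda>i. if i = j then flip (\<omega> i) else \<omega> i)
      (?S (\<lambda>i. if i = j then flip (\<omega> i) else \<omega> i) + g (flip (\<omega> j)))) \<partial>P)"
    by (subst nn_integral_flip_component[where j=j, symmetric]) auto
  \<comment> \<open>Neither \<open>J\<close> nor \<open>K\<close> contains \<open>j\<close>, so the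
    flip affects only the last summand.\<close>
  also have "\<dots> = (\<integral>\<^sup>+\<omega>. ennreal (?R \<omega> (?S \<omega> - g (\<omega> j))) \<partial>P)"
  proof (intro nn_integral_cong arg_cong[where f=ennreal])
    fix \<omega>
    have "?S (\<lambda>i. if i = j then flip (\<omega> i) else \<omega> i) = ?S \<omega>"
      using \<open>j \<notin> K\<close> by (intro sum.cong) auto
    moreover have "?R (\<lambda>i. if i = j then flip (\<omega> i) else \<omega> i) x = ?R \<omega> x" for x
      using insert.hyps by (intro rademacher_mean_cong) auto
    ultimately show "?R (\<lambda>i. if i = j then flip (\<omega> i) else \<omega> i)
      (?S (\<lambda>i. if i = j then flip (\<omega> i) else \<omega> i) + g (flip (\<omega> j))) = ?R \<omega> (?S \<omega> - g (\<omega> j))"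
      by (simp add: g_flip)
  qed
  finally have 2: "I = (\<integral>\<^sup>+\<omega>. ennreal (?R \<omega> (?S \<omega> - g (\<omega> j))) \<partial>P)" .
  have "(\<integral>\<^sup>+\<omega>. ennreal (rademacher_mean (\<lambda>i. g (\<omega> i)) (insert j J) f (?S \<omega>)) \<partial>P)
    = (\<integral>\<^sup>+\<omega>. (ennreal (?R \<omega> (?S \<omega> + g (\<omega> j))) + ennreal (?R \<omega> (?S \<omega> - g (\<omega> j)))) / 2 \<partial>P)"
    using insert.hyps by (simp add: ennreal_average nnR)
  also have "\<dots> = (I + I) / 2"
    by (simp add: nn_integral_divide nn_integral_add flip: 1 2)
  also have "\<dots> = I" by (rule ennreal_average_same)
  finally show ?case unfolding I_def by simp
qed simp

lemma nn_integral_sum_eq_rademacher_mean: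
  assumes "finite J" "f \<in> borel_measurable borel" "\<And>x. f x \<ge> 0"
  shows "(\<integral>\<^sup>+\<omega>. ennreal (f (\<Sum>i\<in>J. g (\<omega> i))) \<partial>P) =
    (\<integral>\<^sup>+\<omega>. ennreal (rademacher_mean (\<lambda>i. g (\<omega> i)) J f 0) \<partial>P)"
  using nn_integral_sum_eq_rademacher_mean_aux[OF assms(1) _ _ assms(2,3), of "{}"] by simp

text \<open>For a sample in \<open>E\<close> the mean square over fresh signs is some
  \<open>F\<close> with \<open>F / 2\<close> at least the square of \<open>t\<close>, so
  Paley-Zygmund gives norm at least \<open>t\<close> with probability at least 1/64 over the signs.
  Integrating over \<open>E\<close> keeps this factor.\<close>

lemma measure_sum_large:
  assumes "finite J" "t > 0" and E[measurable]: "E \<in> sets P"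
    and ge: "\<And>\<omega>. \<omega> \<in> E \<Longrightarrow> rademacher_mean (\<lambda>i. g (\<omega> i)) J (\<lambda>x. (norm x)\<^sup>2) 0 \<ge> 2 * t\<^sup>2"
  shows "P.prob E / 64 \<le> P.prob {\<omega>\<in>space P. norm (\<Sum>i\<in>J. g (\<omega> i)) \<ge> t}"
proof -
  let ?f = "indicator {x::'b. norm x \<ge> t} :: 'b \<Rightarrow> real"
  note [measurable] = borel_measurable_component[of g]
  have "ennreal (P.prob E / 64) = (\<integral>\<^sup>+\<omega>. ennreal (indicator E \<omega> / 64) \<partial>P)"
  proof -
    have "(\<integral>\<^sup>+\<omega>. ennreal (indicator E \<omega> / 64) \<partial>P) = (\<integral>\<^sup>+\<omega>. ennreal (1/64) * indicator E \<omega> \<partial>P)"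
      by (intro nn_integral_cong) (auto simp: indicator_def)
    also have "\<dots> = ennreal (1/64) * emeasure P E"
      by (rule nn_integral_cmult_indicator) simp
    finally show ?thesis
      by (simp add: P.emeasure_eq_measure ennreal_mult[symmetric])
  qed
  also have "\<dots> \<le> (\<integral>\<^sup>+\<omega>. ennreal (rademacher_mean (\<lambda>i. g (\<omega> i)) J ?f 0) \<partial>P)"
  proof (intro nn_integral_mono ennreal_leI)
    fix \<omega>
    show "indicator E \<omega> / 64 \<le> rademacher_mean (\<lambda>i. g (\<omega> i)) J ?f 0"
    proof (cases "\<omega> \<in> E")
      case True
      let ?F = "rademacher_mean (\<lambda>i. g (\<omega> i)) J (\<lambda>x. (norm x)\<^sup>2) 0"
      have F: "?F \<ge> 2 * t\<^sup>2" using ge True by auto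
      with \<open>t > 0\<close> have "?F > 0" by (smt (verit) zero_less_power)
      have "1 / 64 \<le> rademacher_mean (\<lambda>i. g (\<omega> i)) J (indicator {x. (norm x)\<^sup>2 \<ge> ?F / 2}) 0"
        by (rule rademacher_mean_paley_zygmund[OF assms(1) \<open>?F > 0\<close>])
      also have "\<dots> \<le> rademacher_mean (\<lambda>i. g (\<omega> i)) J ?f 0"
      proof (rule rademacher_mean_mono[OF assms(1)])
        fix x :: 'b
        have "t \<le> norm x" if "(norm x)\<^sup>2 \<ge> ?F / 2"
          using F that by (intro power2_le_imp_le[of t]) auto
        then show "indicator {x. (norm x)\<^sup>2 \<ge> ?F / 2} x \<le> ?f x" by (auto simp: indicator_def)
      qed
      finally show ?thesis using True by simp
    next
      case False
      then show ?thesis using assms(1) by (auto intro!: rademacher_mean_nonneg)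
    qed
  qed
  also have "\<dots> = (\<integral>\<^sup>+\<omega>. ennreal (?f (\<Sum>i\<in>J. g (\<omega> i))) \<partial>P)"
    by (rule nn_integral_sum_eq_rademacher_mean[symmetric]) (auto simp: assms)
  also have "\<dots> = (\<integral>\<^sup>+\<omega>. indicator {\<omega>\<in>space P. norm (\<Sum>i\<in>J. g (\<omega> i)) \<ge> t} \<omega> \<partial>P)"
    by (intro nn_integral_cong) (auto simp: indicator_def)
  also have "\<dots> = ennreal (P.prob {\<omega>\<in>space P. norm (\<Sum>i\<in>J. g (\<omega> i)) \<ge> t})"
    by (simp add: P.emeasure_eq_measure)
  finally show ?thesis by simp
qed

end

section \<open>Comparison of families and random subsets\<close>

text \<open>Three comparisons in turn: contraction by \<open>b\<close>, reindexing along the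
  injection \<open>\<iota>\<close>, and enlarging the image of \<open>H\<close> to
  \<open>I\<close>.\<close>

lemma rademacher_mean_dominated:
  assumes "finite I" "inj_on \<iota> H" "\<iota> ` H \<subseteq> I" "convex_on UNIV f"
    and "\<And>j. j \<in> H \<Longrightarrow> \<bar>b j\<bar> \<le> 1" "\<And>j. j \<in> H \<Longrightarrow> v j = b j *\<^sub>R y (\<iota> j)"
  shows "rademacher_mean v H f x \<le> rademacher_mean y I f x"
proof -
  have fin: "finite H" using assms(1-3) by (metis finite_imageD finite_subset)
  have "rademacher_mean v H f x = rademacher_mean (\<lambda>j. b j *\<^sub>R (y \<circ> \<iota>) j) H f x"
    using assms(6) by (intro rademacher_mean_cong[OF fin]) auto
  also have "\<dots> \<le> rademacher_mean (y \<circ> \<iota>) H f x"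
    by (rule rademacher_mean_contraction[OF fin assms(4,5)])
  also have "\<dots> = rademacher_mean y (\<iota> ` H) f x"
    by (rule rademacher_mean_reindex[OF fin assms(2), symmetric])
  also have "\<dots> \<le> rademacher_mean y I f x"
    by (rule rademacher_mean_subset[OF assms(1,3,4)])
  finally show ?thesis .
qed

lemma rademacher_mean_square_scaleR:
  assumes "finite J"
  shows "rademacher_mean (\<lambda>j. c *\<^sub>R v j) J (\<lambda>x. (norm x)\<^sup>2) 0
    = c\<^sup>2 * rademacher_mean v J (\<lambda>x. (norm x)\<^sup>2) 0"
proof -
  have "rademacher_mean (\<lambda>j. c *\<^sub>R v j) J (\<lambda>x. (norm x)\<^sup>2) 0
    = rademacher_mean v J (\<lambda>x. c\<^sup>2 * (norm x)\<^sup>2) 0"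
    using rademacher_mean_scaleR[OF assms, of c v "\<lambda>x. (norm x)\<^sup>2" 0] by (simp add: power_mult_distrib)
  then show ?thesis by (simp add: rademacher_mean_cmult[OF assms])
qed

text \<open>Jensen's inequality applied to the random coefficients \<open>1\<^bsub>j \<in> H\<^esub>\<close>, whose means are at
  least \<open>1/2\<close>, bounds the expected Rademacher mean over \<open>H\<close> by a quarter of the full one.\<close>

lemma (in prob_space) random_subset_rademacher_mean:
  fixes v :: "'i \<Rightarrow> 'b::real_normed_vector" and H :: "'a \<Rightarrow> 'i set"
  assumes "finite J" and sub: "\<And>\<omega>. \<omega> \<in> space M \<Longrightarrow> H \<omega> \<subseteq> J"
    and meas[measurable]: "\<And>j. j \<in> J \<Longrightarrow> {\<omega>\<in>space M. j \<in> H \<omega>} \<in> events"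
    and half: "\<And>j. j \<in> J \<Longrightarrow> prob {\<omega>\<in>space M. j \<in> H \<omega>} \<ge> 1 / 2"
  defines "Z \<equiv> (\<lambda>A. rademacher_mean v A (\<lambda>x. (norm x)\<^sup>2) 0)"
  shows "{\<omega>\<in>space M. Z (H \<omega>) \<ge> Z J / 8} \<in> events"
    and "Z J > 0 \<Longrightarrow> prob {\<omega>\<in>space M. Z (H \<omega>) \<ge> Z J / 8} \<ge> 1 / 8"
proof -
  \<comment> \<open>The events \<open>E A\<close> form a finite partition of the sample space, so
    probabilities and means of functions of \<open>H\<close> become finite sums, to which the finite
    Jensen inequality applies.\<close>
  define E where "E A = {\<omega>\<in>space M. H \<omega> = A}" for A
  have E_meas: "E A \<in> events" if "A \<subseteq> J" for A
  proof -
    have "E A = {\<omega>\<in>space M. \<forall>j\<in>J. (j \<in> H \<omega>) = (j \<in> A)}"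
      using that sub unfolding E_def by blast
    also have "\<dots> \<in> events"
      using assms(1) by (intro sets.sets_Collect_finite_All sets.sets_Collect) (auto intro: meas)
    finally show ?thesis .
  qed
  have union: "prob {\<omega>\<in>space M. Q (H \<omega>)} = (\<Sum>A\<in>{A\<in>Pow J. Q A}. prob (E A))"
    "{\<omega>\<in>space M. Q (H \<omega>)} \<in> events" for Q
  proof -
    have eq: "{\<omega>\<in>space M. Q (H \<omega>)} = (\<Union>A\<in>{A\<in>Pow J. Q A}. E A)"
      using sub unfolding E_def by blast
    have fin: "finite {A\<in>Pow J. Q A}" using assms(1) by auto
    show "prob {\<omega>\<in>space M. Q (H \<omega>)} = (\<Sum>A\<in>{A\<in>Pow J. Q A}. prob (E A))"
      unfolding eq
      by (rule finite_measure_finite_Union[OF fin])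
        (auto simp: disjoint_family_on_def E_meas E_def[abs_def] intro: E_meas[unfolded E_def])
    show "{\<omega>\<in>space M. Q (H \<omega>)} \<in> events"
      unfolding eq using fin E_meas by (intro sets.finite_UN) auto
  qed
  show "{\<omega>\<in>space M. Z (H \<omega>) \<ge> Z J / 8} \<in> events" by (rule union(2))
  assume "Z J > 0"
  have fin: "finite A" if "A \<subseteq> J" for A using that assms(1) by (rule finite_subset)
  define c where "c A = prob (E A)" for A
  have c_sum: "(\<Sum>A\<in>Pow J. c A) = 1"
    using union(1)[of "\<lambda>_. True"] by (simp add: c_def prob_space Pow_def)
  \<comment> \<open>\<open>q j\<close> is the mean of the random coefficient of \<open>v j\<close>.
    Since it is at least 1/2, \<open>1 / (2 * q j)\<close> is an admissible contraction
    factor.\<close>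
  define q where "q j = (\<Sum>A\<in>Pow J. c A * indicator A j)" for j
  have q: "q j \<ge> 1 / 2" if "j \<in> J" for j
  proof -
    have "q j = (\<Sum>A\<in>{A\<in>Pow J. j \<in> A}. c A)"
      unfolding q_def using assms(1) by (intro sum.mono_neutral_cong_right) (auto simp: indicator_def)
    also have "\<dots> = prob {\<omega>\<in>space M. j \<in> H \<omega>}"
      using union(1)[of "\<lambda>A. j \<in> A"] by (simp add: c_def)
    finally show ?thesis using half[OF that] by simp
  qed
  have "Z J / 4 = rademacher_mean (\<lambda>j. (1/2) *\<^sub>R v j) J (\<lambda>x. (norm x)\<^sup>2) 0"
    unfolding rademacher_mean_square_scaleR[OF assms(1)] Z_def by (simp add: power_divide)
  also have "\<dots> \<le> rademacher_mean (\<lambda>j. q j *\<^sub>R v j) J (\<lambda>x. (norm x)\<^sup>2) 0"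
  proof (rule rademacher_mean_dominated[where \<iota> = id and b = "\<lambda>j. 1 / (2 * q j)"])
    fix j assume "j \<in> J"
    with q[of j] show "\<bar>1 / (2 * q j)\<bar> \<le> 1" "(1/2) *\<^sub>R v j = (1 / (2 * q j)) *\<^sub>R (q (id j) *\<^sub>R v (id j))"
      by auto
  qed (use assms(1) convex_on_norm_square in auto)
  also have "\<dots> = rademacher_mean (\<lambda>j. \<Sum>A\<in>Pow J. c A *\<^sub>R indicator A j *\<^sub>R v j) J (\<lambda>x. (norm x)\<^sup>2)
      (\<Sum>A\<in>Pow J. c A *\<^sub>R 0)"
    unfolding q_def by (simp add: scaleR_sum_left)
  also have "\<dots> \<le> (\<Sum>A\<in>Pow J. c A * rademacher_mean (\<lambda>j. indicator A j *\<^sub>R v j) J (\<lambda>x. (norm x)\<^sup>2) 0)"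
    using assms(1) c_sum convex_on_norm_square by (intro rademacher_mean_jensen) (auto simp: c_def)
  also have "\<dots> = (\<Sum>A\<in>Pow J. c A * Z A)"
    unfolding Z_def using assms(1) by (intro sum.cong refl) (simp add: rademacher_mean_indicator)
  \<comment> \<open>Truncation at \<open>Z J / 8\<close>: smaller values contribute at most
    \<open>Z J / 8\<close> in total, the others at most \<open>Z J\<close> times their probability.
    Half of the \<open>Z J / 4\<close> on the left remains for the event.\<close>
  also have "\<dots> \<le> (\<Sum>A\<in>Pow J. c A * (Z J / 8) + (if Z A \<ge> Z J / 8 then c A * Z J else 0))"
  proof (intro sum_mono)
    fix A assume A: "A \<in> Pow J"
    have "c A \<ge> 0" by (simp add: c_def)
    have "Z A \<le> Z J"
      unfolding Z_def using A assms(1) convex_on_norm_square by (intro rademacher_mean_subset) auto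
    with \<open>Z J > 0\<close> have "Z A \<le> Z J / 8 + (if Z A \<ge> Z J / 8 then Z J else 0)"
      by auto
    from mult_left_mono[OF this \<open>c A \<ge> 0\<close>]
    show "c A * Z A \<le> c A * (Z J / 8) + (if Z A \<ge> Z J / 8 then c A * Z J else 0)"
      by (simp only: distrib_left if_distrib[of "\<lambda>x. c A * x"] mult_zero_right)
  qed
  also have "\<dots> = Z J / 8 + (\<Sum>A\<in>Pow J. if Z A \<ge> Z J / 8 then c A * Z J else 0)"
    by (simp only: sum.distrib sum_distrib_right[symmetric] c_sum mult_1)
  also have "(\<Sum>A\<in>Pow J. if Z A \<ge> Z J / 8 then c A * Z J else 0) = (\<Sum>A\<in>{A\<in>Pow J. Z A \<ge> Z J / 8}. c A) * Z J"
    unfolding sum_distrib_right using assms(1) by (intro sum.mono_neutral_cong_right) auto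
  also have "(\<Sum>A\<in>{A\<in>Pow J. Z A \<ge> Z J / 8}. c A) = prob {\<omega>\<in>space M. Z (H \<omega>) \<ge> Z J / 8}"
    unfolding c_def by (rule union(1)[of "\<lambda>A. Z A \<ge> Z J / 8", symmetric])
  finally have "1 / 8 * Z J \<le> prob {\<omega>\<in>space M. Z (H \<omega>) \<ge> Z J / 8} * Z J" by simp
  then show "prob {\<omega>\<in>space M. Z (H \<omega>) \<ge> Z J / 8} \<ge> 1 / 8"
    using \<open>Z J > 0\<close> by (rule mult_right_le_imp_le)
qed

section \<open>Hitting probabilities and the strong law\<close>

context symmetric_index
begin

lemma hit_measurable:
  "{\<omega>\<in>space P. \<exists>i\<in>{1..n::nat}. \<omega> i \<in> D} \<in> sets P"
proof -
  have "{\<omega>\<in>space P. \<omega> i \<in> D} \<in> sets P" for i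
  proof -
    have "(\<lambda>\<omega>. \<omega> i) \<in> P \<rightarrow>\<^sub>M count_space UNIV"
      by (rule measurable_component) auto
    then have "(\<lambda>\<omega>. \<omega> i) -` D \<inter> space P \<in> sets P" by (rule measurable_sets) auto
    then show ?thesis by (simp add: vimage_def Int_def conj_commute)
  qed
  then show ?thesis by (intro sets.sets_Collect_finite_Ex) auto
qed

text \<open>Each independent draw misses \<open>D\<close> with probability at most
  \<open>exp (- 1 / n)\<close>, so all \<open>n\<close> miss with probability at most
  \<open>exp (-1)\<close>, which is below 1/2.\<close>

lemma hit_probability:
  assumes "n \<ge> 1" "measure_pmf.prob \<mu> D \<ge> 1 / real n"
  shows "P.prob {\<omega>\<in>space P. \<exists>i\<in>{1..n}. \<omega> i \<in> D} \<ge> 1 / 2"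
proof -
  interpret Q: product_prob_space "\<lambda>_. measure_pmf \<mu>" "UNIV :: nat set"
    by unfold_locales
  have "P.prob {\<omega>\<in>space P. \<not> (\<exists>i\<in>{1..n}. \<omega> i \<in> D)} = measure P {\<omega>\<in>space P. \<forall>i\<in>{1..n}. \<omega> i \<in> - D}"
    by (intro arg_cong[where f=P.prob]) auto
  also have "\<dots> = (\<Prod>i\<in>{1..n}. measure_pmf.prob \<mu> (- D))"
    using Q.emeasure_PiM_Collect[of "{1..n}" "\<lambda>_. - D"] 
    unfolding measure_def P_def[symmetric] by (simp add: measure_pmf.emeasure_eq_measure prod_ennreal ennreal_power)
  also have "\<dots> = (1 - measure_pmf.prob \<mu> D) ^ n"
    by (simp add: measure_pmf.prob_compl[of D, simplified] Compl_eq_Diff_UNIV)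
  also have "\<dots> \<le> exp (- (1 / real n)) ^ n"
  proof (intro power_mono)
    show "1 - measure_pmf.prob \<mu> D \<le> exp (- (1 / real n))"
      using exp_ge_add_one_self[of "- (1 / real n)"] assms(2) by linarith
  qed simp
  also have "\<dots> = exp (-1)"
    using assms(1) by (simp flip: exp_of_nat_mult)
  also have "\<dots> \<le> 1 / 2"
    using exp_ge_add_one_self[of 1] by (simp add: exp_minus field_simps)
  finally show ?thesis
    using P.prob_neg[OF hit_measurable[of n D]] by simp
qed

text \<open>The strong-law hypothesis speaks of sample spaces of type
  \<open>nat \<Rightarrow> 'b\<close>, so it is applied to the product \<open>M\<close> of copies of
  the law of \<open>g\<close>. The almost sure limit is then pulled back to \<open>P\<close>, and
  dominated convergence turns it into a limit of probabilities.\<close>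

lemma SLLN_in_probability:
  assumes SLLN: "symmetric_SLLN_equivalence a TYPE('b)" and pos: "\<And>n. n \<ge> 1 \<Longrightarrow> a n > 0"
    and sum: "summable (\<lambda>n. measure_pmf.prob \<mu> {z. norm (g z) > a (Suc n)})"
  shows "(\<lambda>n. P.prob {\<omega>\<in>space P. norm (\<Sum>i=1..n. g (\<omega> i)) \<ge> a n}) \<longlonglongrightarrow> 0"
proof -
  define D where "D = distr (measure_pmf \<mu>) borel g"
  define M where "M = PiM UNIV (\<lambda>_::nat. D)"
  have sets_D[measurable_cong]: "sets D = sets borel" and space_D: "space D = UNIV" by (simp_all add: D_def)
  interpret D: prob_space D
    unfolding D_def by (rule measure_pmf.prob_space_distr) simp
  interpret Q: product_prob_space "\<lambda>_. D" "UNIV :: nat set"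
    by unfold_locales
  interpret M: prob_space M
    unfolding M_def by (rule prob_space_PiM) unfold_locales
  have coord[measurable]: "(\<lambda>\<omega>. \<omega> i) \<in> borel_measurable M" for i
  proof -
    have "(\<lambda>\<omega>. \<omega> i) \<in> M \<rightarrow>\<^sub>M D" unfolding M_def by (rule measurable_component_singleton) simp
    then show ?thesis by (simp cong: measurable_cong_sets add: sets_D)
  qed
  have distr_coord: "distr M borel (\<lambda>\<omega>. \<omega> i) = D" for i
  proof -
    have "distr M borel (\<lambda>\<omega>. \<omega> i) = distr M D (\<lambda>\<omega>. \<omega> i)"
      by (rule distr_cong) (simp_all add: sets_D)
    also have "\<dots> = D" unfolding M_def by (rule Q.PiM_component) simp
    finally show ?thesis .
  qed
  \<comment> \<open>Coordinate 0 serves as \<open>X\<close>; the sequence itself uses the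
    coordinates from 1 on.\<close>
  have "iid_copies M (\<lambda>\<omega>. \<omega> 0) (\<lambda>n \<omega>. \<omega> n)"
    unfolding iid_copies_def
  proof (intro conjI allI impI)
    show "prob_space M" by unfold_locales
    show "M.indep_vars (\<lambda>_. borel) (\<lambda>n \<omega>. \<omega> n) {1..}"
    proof (subst M.indep_vars_iff_distr_eq_PiM')
      have "distr M (PiM {1..} (\<lambda>_. borel)) (\<lambda>x. \<lambda>i\<in>{1..}. x i) =
          distr (PiM UNIV (\<lambda>_. D)) (PiM {1..} (\<lambda>_. D)) (\<lambda>x. \<lambda>i\<in>{1..}. x i)"
        unfolding M_def by (rule distr_cong) (auto simp: sets_D cong: sets_PiM_cong)
      also have "\<dots> = PiM {1..} (\<lambda>_. D)"
        using distr_PiM_reindex[of UNIV "\<lambda>_. D" id "{1::nat..}"] D.prob_space_axioms by simp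
      finally show "distr M (PiM {1..} (\<lambda>_. borel)) (\<lambda>x. \<lambda>i\<in>{1..}. x i) =
          PiM {1..} (\<lambda>i. distr M borel (\<lambda>\<omega>. \<omega> i))"
        by (simp add: distr_coord)
    qed auto
  qed (auto simp: distr_coord)
  moreover have "symmetric_rv M (\<lambda>\<omega>. \<omega> 0)"
  proof -
    have "distr M borel (\<lambda>\<omega>. - \<omega> 0) = distr D borel uminus"
      unfolding distr_coord[of 0, symmetric] by (subst distr_distr) (auto simp: comp_def)
    also have "\<dots> = distr (measure_pmf \<mu>) borel (\<lambda>z. g (flip z))"
      unfolding D_def by (subst distr_distr) (auto simp: comp_def g_flip)
    also have "\<dots> = distr (measure_pmf (map_pmf flip \<mu>)) borel g"
      unfolding map_pmf_rep_eq by (subst distr_distr) (auto simp: comp_def)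
    also have "\<dots> = D" by (simp add: map_flip D_def)
    finally show ?thesis by (simp add: symmetric_rv_def distr_coord)
  qed
  moreover have "summable (\<lambda>n. measure M {\<omega> \<in> space M. norm (\<omega> 0) > a (Suc n)})"
  proof -
    have "measure M {\<omega> \<in> space M. norm (\<omega> 0) > t} = measure_pmf.prob \<mu> {z. norm (g z) > t}" for t
    proof -
      have "measure M {\<omega> \<in> space M. norm (\<omega> 0) > t} = measure (distr M borel (\<lambda>\<omega>. \<omega> 0)) {x. norm x > t}"
        by (subst measure_distr) (auto intro!: arg_cong[where f="measure M"])
      also have "\<dots> = measure_pmf.prob \<mu> {z. norm (g z) > t}"
        unfolding distr_coord D_def by (subst measure_distr) (auto simp: vimage_def)
      finally show ?thesis .
    qed
    with sum show ?thesis by simp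
  qed
  ultimately have AE_M: "AE \<omega> in M. (\<lambda>n. (\<Sum>i=1..n. \<omega> i) /\<^sub>R a n) \<longlonglongrightarrow> 0"
    using SLLN unfolding symmetric_SLLN_equivalence_def by blast
  have meas: "(\<lambda>\<omega> i. g (\<omega> i)) \<in> P \<rightarrow>\<^sub>M PiM UNIV (\<lambda>_. borel)"
    by (rule measurable_PiM_single') (auto simp: borel_measurable_component)
  \<comment> \<open>Seeing \<open>M\<close> as an image of \<open>P\<close> lets almost sure
    statements return to \<open>P\<close>.\<close>
  have M_eq: "M = distr P (PiM UNIV (\<lambda>_. borel)) (\<lambda>\<omega> i. g (\<omega> i))"
    unfolding M_def D_def P_def
    by (rule distr_PiM_UNIV[symmetric]) (auto simp: prob_space_measure_pmf)
  have AE: "AE \<omega> in P. (\<lambda>n. (\<Sum>i=1..n. g (\<omega> i)) /\<^sub>R a n) \<longlonglongrightarrow> 0"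
    by (rule AE_distrD[OF meas AE_M[unfolded M_eq]])
  define s where "s n = (indicator {\<omega>\<in>space P. norm (\<Sum>i=1..n. g (\<omega> i)) \<ge> a n} :: _ \<Rightarrow> real)" for n
  note [measurable] = borel_measurable_component[of g]
  have "(\<lambda>n. \<integral>\<omega>. s n \<omega> \<partial>P) \<longlonglongrightarrow> (\<integral>\<omega>. 0 \<partial>P)"
  proof (rule integral_dominated_convergence[where w="\<lambda>_. 1"])
    show "AE \<omega> in P. (\<lambda>n. s n \<omega>) \<longlonglongrightarrow> 0"
      using AE
    proof eventually_elim
      fix \<omega> assume "(\<lambda>n. (\<Sum>i=1..n. g (\<omega> i)) /\<^sub>R a n) \<longlonglongrightarrow> 0"
      then have "eventually (\<lambda>n. norm ((\<Sum>i=1..n. g (\<omega> i)) /\<^sub>R a n) < 1) sequentially"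
        by (rule order_tendstoD(2)[OF tendsto_norm_zero]) simp
      then have "eventually (\<lambda>n. s n \<omega> = 0) sequentially"
        using eventually_ge_at_top[of 1]
      proof eventually_elim
        case (elim n)
        have "norm (\<Sum>i=1..n. g (\<omega> i)) < a n"
          using elim pos[of n] by (simp add: field_simps)
        then show ?case by (simp add: s_def)
      qed
      then show "(\<lambda>n. s n \<omega>) \<longlonglongrightarrow> 0" by (rule tendsto_eventually)
    qed
  qed (auto simp: s_def indicator_def)
  then show ?thesis by (simp add: s_def)
qed

end

section \<open>Rademacher sequences and type\<close>

text \<open>Links the recursive sign averages to an arbitrary Rademacher sequence. For a new sign,
  independence and Fubini integrate out the other signs first, at a shifted starting point; hence
  the general \<open>x\<close>.\<close>

lemma rademacher_seq_nn_integral: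
  fixes v :: "nat \<Rightarrow> 'b::{banach, second_countable_topology}"
  assumes R: "rademacher_seq N R" and J: "finite J" "J \<subseteq> {1..}"
    and f[measurable]: "f \<in> borel_measurable borel" and nn: "\<And>x. f x \<ge> 0"
  shows "(\<integral>\<^sup>+\<omega>. ennreal (f (x + (\<Sum>i\<in>J. R i \<omega> *\<^sub>R v i))) \<partial>N) = ennreal (rademacher_mean v J f x)"
  using J
proof (induction J arbitrary: x rule: finite_induct)
  case empty
  interpret prob_space N using R by (simp add: rademacher_seq_def)
  show ?case by (simp add: emeasure_space_1)
next
  case (insert j J)
  interpret prob_space N using R by (simp add: rademacher_seq_def)
  have indep: "indep_vars (\<lambda>_. borel) R {1..}" using R by (simp add: rademacher_seq_def)
  have R_meas: "R i \<in> borel_measurable N" if "i \<ge> 1" for i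
    using indep that by (auto simp: indep_vars_def)
  have j: "j \<ge> 1" and J: "J \<subseteq> {1..}" using insert.prems by auto
  have half: "prob {\<omega>\<in>space N. R j \<omega> = 1} = 1 / 2" "prob {\<omega>\<in>space N. R j \<omega> = - 1} = 1 / 2"
    using R j unfolding rademacher_seq_def by blast+
  note [measurable] = R_meas[OF j]
  let ?X = "\<lambda>\<omega>. R j \<omega> *\<^sub>R v j"
  let ?Y = "\<lambda>\<omega>. \<Sum>i\<in>J. R i \<omega> *\<^sub>R v i"
  let ?G = "rademacher_mean v J f"
  have [measurable]: "?Y \<in> borel_measurable N"
    using J R_meas by (intro borel_measurable_sum borel_measurable_scaleR) auto
  have "indep_vars (\<lambda>_. borel) R (insert j J)"
    by (rule indep_vars_subset[OF indep]) (use j J in auto)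
  then have "indep_var borel ((\<lambda>r. r j *\<^sub>R v j) \<circ> (\<lambda>\<omega>. restrict (\<lambda>i. R i \<omega>) {j}))
      borel ((\<lambda>r. \<Sum>i\<in>J. r i *\<^sub>R v i) \<circ> (\<lambda>\<omega>. restrict (\<lambda>i. R i \<omega>) J))"
    using insert.hyps by (intro indep_var_compose[OF indep_var_restrict]) auto
  also have "(\<lambda>r. \<Sum>i\<in>J. r i *\<^sub>R v i) \<circ> (\<lambda>\<omega>. restrict (\<lambda>i. R i \<omega>) J) = ?Y"
    by auto
  also have "(\<lambda>r. r j *\<^sub>R v j) \<circ> (\<lambda>\<omega>. restrict (\<lambda>i. R i \<omega>) {j}) = ?X" by auto
  finally have joint: "distr N borel ?X \<Otimes>\<^sub>M distr N borel ?Y = distr N (borel \<Otimes>\<^sub>M borel) (\<lambda>\<omega>. (?X \<omega>, ?Y \<omega>))"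
    unfolding indep_var_distribution_eq by auto
  interpret Y: prob_space "distr N borel ?Y" by (rule prob_space_distr) simp
  have [measurable]: "?G \<in> borel_measurable borel"
    by (rule borel_measurable_rademacher_mean[where v = "\<lambda>_. v" and x = "\<lambda>x. x"])
      (use insert.hyps in auto)
  let ?h = "\<lambda>(r, y). ennreal (f (x + r + y))"
  have "(\<integral>\<^sup>+\<omega>. ennreal (f (x + (\<Sum>i\<in>insert j J. R i \<omega> *\<^sub>R v i))) \<partial>N) = (\<integral>\<^sup>+\<omega>. ?h (?X \<omega>, ?Y \<omega>) \<partial>N)"
    using insert.hyps by (simp add: add.assoc)
  also have "\<dots> = (\<integral>\<^sup>+z. ?h z \<partial>(distr N borel ?X \<Otimes>\<^sub>M distr N borel ?Y))"
    unfolding joint by (subst nn_integral_distr) auto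
  also have "\<dots> = (\<integral>\<^sup>+r. \<integral>\<^sup>+y. ?h (r, y) \<partial>distr N borel ?Y \<partial>distr N borel ?X)"
    by (rule Y.nn_integral_fst[symmetric]) simp
  also have "\<dots> = (\<integral>\<^sup>+r. ennreal (?G (x + r)) \<partial>distr N borel ?X)"
  proof (rule nn_integral_cong)
    fix r
    show "(\<integral>\<^sup>+y. ?h (r, y) \<partial>distr N borel ?Y) = ennreal (?G (x + r))"
      using insert.IH[OF J, of "x + r"] by (subst nn_integral_distr) auto
  qed
  also have "\<dots> = (\<integral>\<^sup>+\<omega>. ennreal (?G (x + R j \<omega> *\<^sub>R v j)) \<partial>N)"
    by (subst nn_integral_distr) auto
  also have "\<dots> = (\<integral>\<^sup>+\<omega>. ennreal (?G (x + v j)) * indicator {\<omega>\<in>space N. R j \<omega> = 1} \<omega>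
      + ennreal (?G (x - v j)) * indicator {\<omega>\<in>space N. R j \<omega> = -1} \<omega> \<partial>N)"
  proof (rule nn_integral_cong_AE)
    \<comment> \<open>The two given probabilities add up to 1, so \<open>R j\<close> almost surely
      takes no other value.\<close>
    have "prob {\<omega>\<in>space N. R j \<omega> = 1 \<or> R j \<omega> = -1} =
        prob ({\<omega>\<in>space N. R j \<omega> = 1} \<union> {\<omega>\<in>space N. R j \<omega> = -1})"
      by (intro arg_cong[where f=prob]) auto
    also have "\<dots> = prob {\<omega>\<in>space N. R j \<omega> = 1} + prob {\<omega>\<in>space N. R j \<omega> = -1}"
      by (rule finite_measure_Union) auto
    also have "\<dots> = 1" by (simp add: half)
    finally have "AE \<omega> in N. R j \<omega> = 1 \<or> R j \<omega> = -1"
      by (subst (asm) prob_Collect_eq_1) auto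
    then show "AE \<omega> in N. ennreal (?G (x + R j \<omega> *\<^sub>R v j)) =
      ennreal (?G (x + v j)) * indicator {\<omega>\<in>space N. R j \<omega> = 1} \<omega>
      + ennreal (?G (x - v j)) * indicator {\<omega>\<in>space N. R j \<omega> = -1} \<omega>"
      by (rule AE_mp) (auto intro!: AE_I2 simp: indicator_def)
  qed
  also have "\<dots> = ennreal (?G (x + v j)) * ennreal (1/2) + ennreal (?G (x - v j)) * ennreal (1/2)"
    by (subst nn_integral_add) (auto simp: nn_integral_cmult_indicator emeasure_eq_measure half)
  also have "\<dots> = ennreal (rademacher_mean v (insert j J) f x)"
  proof -
    have "?G y \<ge> 0" for y using insert.hyps nn by (intro rademacher_mean_nonneg) auto
    moreover have "ennreal a * ennreal (1/2) + ennreal b * ennreal (1/2) = ennreal ((a + b) / 2)"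
      if "a \<ge> 0" "b \<ge> 0" for a b
    proof -
      have "ennreal ((a + b) / 2) = ennreal (a * (1/2) + b * (1/2))" by (simp add: add_divide_distrib)
      also have "\<dots> = ennreal (a * (1/2)) + ennreal (b * (1/2))"
        by (rule ennreal_plus) (use that in auto)
      finally show ?thesis using that by (simp only: ennreal_mult')
    qed
    ultimately show ?thesis unfolding rademacher_mean_insert[OF insert.hyps] by blast
  qed
  finally show ?case .
qed

section \<open>From second moments of finite sums to Rademacher type\<close>

text \<open>Along a fast subsequence, errors above \<open>(1/2)^i\<close> have probability below
  \<open>(1/2)^i\<close>, and Borel-Cantelli applies.\<close>

lemma converges_in_prob_AE_subsequence:
  assumes "finite_measure M" and conv: "converges_in_prob M Y S"
    and Y[measurable]: "\<And>n. Y n \<in> borel_measurable M"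
  obtains r where "AE \<omega> in M. (\<lambda>i. Y (r i) \<omega>) \<longlonglongrightarrow> S \<omega>"
proof -
  interpret finite_measure M by fact
  have [measurable]: "S \<in> borel_measurable M" using conv by (simp add: converges_in_prob_def)
  have "\<exists>n. measure M {\<omega>\<in>space M. norm (Y n \<omega> - S \<omega>) > (1/2)^i} < (1/2)^i" for i
  proof -
    have "(\<lambda>n. measure M {\<omega>\<in>space M. norm (Y n \<omega> - S \<omega>) > (1/2)^i}) \<longlonglongrightarrow> 0"
      using conv by (simp add: converges_in_prob_def)
    from order_tendstoD(2)[OF this, of "(1/2)^i"] show ?thesis
      by (auto simp: eventually_sequentially)
  qed
  then obtain r where r: "\<And>i. measure M {\<omega>\<in>space M. norm (Y (r i) \<omega> - S \<omega>) > (1/2)^i} < (1/2)^i"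
    by metis
  let ?A = "\<lambda>i. {\<omega>\<in>space M. norm (Y (r i) \<omega> - S \<omega>) > (1/2)^i}"
  have "summable (\<lambda>i. measure M (?A i))"
    by (rule summable_comparison_test[OF _ summable_geometric[of "1/2::real"]])
      (use r in \<open>auto intro!: exI[of _ 0] less_imp_le\<close>)
  then have "AE \<omega> in M. eventually (\<lambda>i. \<omega> \<in> space M - ?A i) sequentially"
    by (intro borel_cantelli_AE1) (auto simp: less_top[symmetric])
  then have "AE \<omega> in M. (\<lambda>i. Y (r i) \<omega>) \<longlonglongrightarrow> S \<omega>"
  proof eventually_elim
    case (elim \<omega>)
    have "(\<lambda>i. Y (r i) \<omega> - S \<omega>) \<longlonglongrightarrow> 0"
    proof (rule Lim_null_comparison)
      show "eventually (\<lambda>i. norm (Y (r i) \<omega> - S \<omega>) \<le> (1/2)^i) sequentially"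
        using elim by eventually_elim auto
      show "(\<lambda>i. (1/2::real)^i) \<longlonglongrightarrow> 0" by (rule LIMSEQ_power_zero) simp
    qed
    then show ?case by (simp add: LIM_zero_iff)
  qed
  then show ?thesis by (rule that)
qed

text \<open>After division by the scale \<open>l\<close>, the power \<open>p\<close> is at most 1
  below the scale and at most the square above it. Being pointwise, this compares the
  \<open>p\<close>-th with the second moment by linearity alone.\<close>

lemma powr_le_powr_mult_square:
  fixes y l p :: real
  assumes "y \<ge> 0" "l > 0" "0 \<le> p" "p \<le> 2"
  shows "y powr p \<le> l powr p * (1 + y\<^sup>2 / l\<^sup>2)"
proof -
  have "(y / l) powr p \<le> 1 + (y / l)\<^sup>2"
  proof (cases "y \<le> l")
    case True
    then have "(y / l) powr p \<le> 1 powr p" using assms by (intro powr_mono2) auto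
    also have "\<dots> \<le> 1 + (y / l)\<^sup>2" by simp
    finally show ?thesis .
  next
    case False
    then have "(y / l) powr p \<le> (y / l) powr 2" using assms by (intro powr_mono) auto
    also have "\<dots> = (y / l)\<^sup>2" using False assms by (simp add: powr_numeral)
    finally show ?thesis by simp
  qed
  then have "l powr p * (y / l) powr p \<le> l powr p * (1 + (y / l)\<^sup>2)"
    by (rule mult_left_mono) simp
  also have "l powr p * (y / l) powr p = y powr p" using assms by (simp add: powr_divide)
  finally show ?thesis by (simp add: power_divide)
qed

text \<open>The second-moment bound controls the \<open>p\<close>-th moments of all partial sums
  uniformly; Fatou's lemma along an almost surely convergent subsequence carries this to any version
  \<open>S\<close> of the limit.\<close>

lemma rademacher_type_if_square_bound:
  fixes p K :: real
  assumes R: "rademacher_seq N R" and p: "0 < p" "p \<le> 2" and K: "K \<ge> 0"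
    and bound: "\<And>(v :: nat \<Rightarrow> 'b::{banach, second_countable_topology}) k.
      rademacher_mean v {1..k} (\<lambda>x. (norm x)\<^sup>2) 0 \<le> K * (\<Sum>i=1..k. norm (v i) powr p) powr (2 / p)"
  shows "rademacher_type N R p TYPE('b)"
  unfolding rademacher_type_def
proof (intro exI[of _ "1 + K"] conjI ballI allI impI)
  show "1 + K > 0" using K by simp
  fix v :: "nat \<Rightarrow> 'b" and S
  assume conv: "converges_in_prob N (rademacher_sums R v) S"
  interpret prob_space N using R by (simp add: rademacher_seq_def)
  have [measurable]: "S \<in> borel_measurable N" using conv by (simp add: converges_in_prob_def)
  have R_meas: "R i \<in> borel_measurable N" if "i \<ge> 1" for i
    using R that by (auto simp: indep_vars_def rademacher_seq_def)
  have Y_meas[measurable]: "rademacher_sums R v n \<in> borel_measurable N" for n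
    unfolding rademacher_sums_def[abs_def]
    using R_meas by (intro borel_measurable_sum borel_measurable_scaleR) auto
  define T where "T = (\<Sum>n. ennreal (norm (v (Suc n)) powr p))"
  have moment: "(\<integral>\<^sup>+\<omega>. ennreal (norm (rademacher_sums R v n \<omega>) powr p) \<partial>N) \<le> ennreal (1 + K) * T" for n
  proof -
    define W where "W = (\<Sum>i=1..n. norm (v i) powr p)"
    have "W \<ge> 0" unfolding W_def by (intro sum_nonneg) auto
    have W_T: "ennreal W \<le> T"
    proof -
      have "ennreal W = (\<Sum>i<n. ennreal (norm (v (Suc i)) powr p))"
        unfolding W_def by (simp add: sum.atLeast1_atMost_eq)
      also have "\<dots> \<le> T" unfolding T_def by (rule sum_le_suminf) auto
      finally show ?thesis .
    qed
    show ?thesis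
    \<comment> \<open>Without positive \<open>W\<close> there is no scale to divide by, but then all
      the vectors vanish.\<close>
    proof (cases "W = 0")
      case True
      then have "\<forall>i\<in>{1..n}. norm (v i) powr p = 0"
        unfolding W_def by (subst (asm) sum_nonneg_eq_0_iff) auto
      then have "rademacher_sums R v n \<omega> = 0" for \<omega>
        by (auto simp: rademacher_sums_def)
      then show ?thesis by simp
    next
      case False
      with \<open>W \<ge> 0\<close> have "W > 0" by simp
      \<comment> \<open>At this scale the square of \<open>l\<close> is the power of
        \<open>W\<close> in \<open>bound\<close>, so the second-moment term becomes
        \<open>K * W\<close> and the total \<open>(1 + K) * W\<close>.\<close>
      define l where "l = W powr (1 / p)"
      have l: "l > 0" "l powr p = W" "l\<^sup>2 = W powr (2 / p)"
        using \<open>W > 0\<close> p by (simp_all add: l_def powr_powr power2_eq_square powr_add[symmetric])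
      let ?f = "\<lambda>x::'b. W * (1 + (norm x)\<^sup>2 / l\<^sup>2)"
      have "(\<integral>\<^sup>+\<omega>. ennreal (norm (rademacher_sums R v n \<omega>) powr p) \<partial>N)
        \<le> (\<integral>\<^sup>+\<omega>. ennreal (?f (0 + (\<Sum>i=1..n. R i \<omega> *\<^sub>R v i))) \<partial>N)"
        using powr_le_powr_mult_square[of _ l p] l p
        by (intro nn_integral_mono ennreal_leI) (simp add: rademacher_sums_def)
      also have "\<dots> = ennreal (rademacher_mean v {1..n} ?f 0)"
        using \<open>W > 0\<close> by (intro rademacher_seq_nn_integral[OF R]) auto
      also have "rademacher_mean v {1..n} ?f 0 = rademacher_mean v {1..n} (\<lambda>x. W * 1 + (W / l\<^sup>2) * (norm x)\<^sup>2) 0"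
        by (simp add: algebra_simps)
      also have "\<dots> = W + (W / l\<^sup>2) * rademacher_mean v {1..n} (\<lambda>x. (norm x)\<^sup>2) 0"
        by (simp only: rademacher_mean_add rademacher_mean_cmult rademacher_mean_const finite_atLeastAtMost mult_1_right)
      also have "\<dots> \<le> W + (W / l\<^sup>2) * (K * l\<^sup>2)"
        using bound[of v n] \<open>W > 0\<close> unfolding l(3) W_def
        by (intro add_left_mono mult_left_mono) auto
      also have "\<dots> = (1 + K) * W" using l(1) by (simp add: field_simps)
      finally have "(\<integral>\<^sup>+\<omega>. ennreal (norm (rademacher_sums R v n \<omega>) powr p) \<partial>N) \<le> ennreal ((1 + K) * W)"
        by (simp add: ennreal_leI)
      also have "\<dots> = ennreal (1 + K) * ennreal W"
        using K \<open>W > 0\<close> by (intro ennreal_mult) auto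
      also have "\<dots> \<le> ennreal (1 + K) * T" using W_T by (rule mult_left_mono) simp
      finally show ?thesis .
    qed
  qed
  obtain r where r: "AE \<omega> in N. (\<lambda>i. rademacher_sums R v (r i) \<omega>) \<longlonglongrightarrow> S \<omega>"
    using converges_in_prob_AE_subsequence[OF _ conv Y_meas] finite_measure_axioms by blast
  have "(\<integral>\<^sup>+\<omega>. ennreal (norm (S \<omega>) powr p) \<partial>N) =
      (\<integral>\<^sup>+\<omega>. liminf (\<lambda>i. ennreal (norm (rademacher_sums R v (r i) \<omega>) powr p)) \<partial>N)"
  proof (rule nn_integral_cong_AE, use r in eventually_elim)
    case (elim \<omega>)
    show ?case
      using p by (intro lim_imp_Liminf[symmetric] tendsto_ennrealI tendsto_powr' tendsto_norm elim tendsto_const) auto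
  qed
  also have "\<dots> \<le> liminf (\<lambda>i. \<integral>\<^sup>+\<omega>. ennreal (norm (rademacher_sums R v (r i) \<omega>) powr p) \<partial>N)"
    by (rule nn_integral_liminf) simp
  also have "\<dots> \<le> liminf (\<lambda>i::nat. ennreal (1 + K) * T)"
    by (intro Liminf_mono always_eventually allI moment)
  also have "\<dots> = ennreal (1 + K) * T" by (simp add: Liminf_const)
  finally show "(\<integral>\<^sup>+ \<omega>. ennreal (norm (S \<omega>) powr p) \<partial>N)
      \<le> ennreal (1 + K) * (\<Sum>n. ennreal (norm (v (Suc n)) powr p))"
    unfolding T_def .
qed

section \<open>The mixture of bad families\<close>

lemma symmetric_index_random_sign:
  fixes h :: "'z \<Rightarrow> 'b::{banach, second_countable_topology}"
  shows "symmetric_index (pair_pmf (pmf_of_set UNIV) \<nu>) (apfst Not) (\<lambda>(b, z). if b then h z else - h z)"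
proof
  have "map_pmf Not (pmf_of_set UNIV) = pmf_of_set (UNIV :: bool set)"
    by (rule map_pmf_of_set_bij_betw) (auto simp: bij_betw_def inj_on_def UNIV_bool)
  then show "map_pmf (apfst Not) (pair_pmf (pmf_of_set UNIV) \<nu>) = pair_pmf (pmf_of_set UNIV) \<nu>"
    by (simp flip: pair_map_pmf1)
qed (auto split: prod.split)

text \<open>Monotonicity between \<open>l\<close> and \<open>n\<close> gives
  \<open>a l >= a n * (l / n) powr (1 / p)\<close>, and \<open>ge\<close> bounds
  \<open>l / n\<close> from below by \<open>\<delta> / W\<close> times the \<open>p\<close>-th power
  of the norm.\<close>

lemma level_dominates:
  fixes a :: "nat \<Rightarrow> real" and v :: "'b::real_normed_vector"
  assumes p: "p > 0" and pos: "\<And>n. n \<ge> 1 \<Longrightarrow> a n > 0"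
    and mono: "mono_on {1..} (\<lambda>n. real n powr (1 / p) / a n)"
    and W: "W > 0" and \<delta>: "\<delta> > 0" and l: "1 \<le> l" "l \<le> n"
    and ge: "real n * \<delta> * (norm v powr p / W) \<le> real l"
  shows "(\<delta> / W) powr (1 / p) * a n * norm v \<le> a l"
proof -
  have n: "n \<ge> 1" using l by simp
  have "real n powr (1 / p) * ((\<delta> / W) powr (1 / p) * norm v) = (real n * \<delta> * (norm v powr p / W)) powr (1 / p)"
  proof -
    have "norm v = (norm v powr p) powr (1 / p)"
      using p by (cases "v = 0") (simp_all add: powr_powr)
    then have "real n powr (1 / p) * ((\<delta> / W) powr (1 / p) * norm v) =
        real n powr (1 / p) * ((\<delta> / W) powr (1 / p) * (norm v powr p) powr (1 / p))"
      by simp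
    also have "\<dots> = (real n * ((\<delta> / W) * norm v powr p)) powr (1 / p)"
      using W \<delta> by (simp add: powr_mult powr_divide)
    finally show ?thesis by (simp add: mult.assoc)
  qed
  also have "\<dots> \<le> real l powr (1 / p)"
    using ge p W \<delta> by (intro powr_mono2) auto
  also have "\<dots> \<le> a l * (real n powr (1 / p) / a n)"
    using mono_onD[OF mono, of l n] l pos[of l] by (simp add: field_simps)
  finally have "real n powr (1 / p) * ((\<delta> / W) powr (1 / p) * norm v) \<le> real n powr (1 / p) * (a l / a n)"
    by (simp add: mult.commute)
  then have "(\<delta> / W) powr (1 / p) * norm v \<le> a l / a n"
    by (rule mult_left_le_imp_le) (use n in simp)
  then show ?thesis using pos[OF n] by (simp add: field_simps)
qed

text \<open>By strict monotonicity only indices below \<open>l\<close> count. The sum is the number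
  of thresholds under \<open>x\<close>, whose expectation is a sum of tail probabilities.\<close>

lemma suminf_indicator_less_level:
  fixes a :: "nat \<Rightarrow> real"
  assumes a: "strict_mono_on {1..} a" and l: "x \<le> a (Suc l)"
  shows "(\<Sum>i. indicator {i. a (Suc i) < x} i :: ennreal) \<le> of_nat l"
proof -
  have less: "i < l" if "a (Suc i) < x" for i
  proof -
    have "a (Suc i) < a (Suc l)" using that l by simp
    then show ?thesis using strict_mono_on_less[OF a, of "Suc i" "Suc l"] by simp
  qed
  have "(\<Sum>i. indicator {i. a (Suc i) < x} i :: ennreal) = (\<Sum>i<l. indicator {i. a (Suc i) < x} i)"
    by (rule suminf_finite) (auto simp: indicator_def dest: less)
  also have "\<dots> \<le> (\<Sum>i<l. 1)" by (rule sum_mono) (simp add: indicator_def)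
  finally show ?thesis by simp
qed

section \<open>Contradiction between the mixture and the strong law\<close>

lemma rademacher_mean_bounded_if_SLLN:
  fixes p :: real and a :: "nat \<Rightarrow> real"
  assumes p: "p > 0" and a: "strict_mono_on {1..} a" and pos: "\<And>n. n \<ge> 1 \<Longrightarrow> a n > 0"
    and mono: "mono_on {1..} (\<lambda>n. real n powr (1 / p) / a n)"
    and SLLN: "symmetric_SLLN_equivalence a TYPE('b::{banach, second_countable_topology})"
  shows "\<exists>K\<ge>0. \<forall>(v :: nat \<Rightarrow> 'b) k.
    rademacher_mean v {1..k} (\<lambda>x. (norm x)\<^sup>2) 0 \<le> K * (\<Sum>i=1..k. norm (v i) powr p) powr (2 / p)"
proof (rule ccontr)
  assume contra: "\<not> ?thesis"
  \<comment> \<open>\<open>\<delta> m\<close> is the weight that \<open>geometric_pmf (1/2)\<close>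
    gives to family \<open>m\<close>. The violation factor chosen next compensates for this rarity
    by its power of \<open>\<delta> m\<close>; of the 16, a factor 8 pays for restricting to the hit
    indices and 2 for Paley-Zygmund.\<close>
  define \<delta> :: "nat \<Rightarrow> real" where "\<delta> m = (1/2) ^ Suc m" for m
  have \<delta>: "\<delta> m > 0" for m by (simp add: \<delta>_def)
  have "\<exists>(v :: nat \<Rightarrow> 'b) k. rademacher_mean v {1..k} (\<lambda>x. (norm x)\<^sup>2) 0 >
      16 * \<delta> m powr (- (2 / p)) * (\<Sum>i=1..k. norm (v i) powr p) powr (2 / p)" for m
    using contra by (metis linorder_not_less mult_nonneg_nonneg powr_ge_zero zero_le_numeral)
  then obtain v :: "nat \<Rightarrow> nat \<Rightarrow> 'b" and k :: "nat \<Rightarrow> nat" where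
    large: "\<And>m. rademacher_mean (v m) {1..k m} (\<lambda>x. (norm x)\<^sup>2) 0 >
      16 * \<delta> m powr (- (2 / p)) * (\<Sum>i=1..k m. norm (v m i) powr p) powr (2 / p)"
    by metis
  define Z where "Z m A = rademacher_mean (v m) A (\<lambda>x. (norm x)\<^sup>2) 0" for m A
  define W where "W m = (\<Sum>i=1..k m. norm (v m i) powr p)" for m
  have Z_large: "Z m {1..k m} > 16 * \<delta> m powr (- (2 / p)) * W m powr (2 / p)" for m
    using large unfolding Z_def W_def .
  have Z_pos: "Z m {1..k m} > 0" for m
    using Z_large[of m] by (rule le_less_trans[rotated]) simp
  have W: "W m > 0" for m
  proof (rule ccontr)
    assume "\<not> W m > 0"
    moreover have "W m \<ge> 0" unfolding W_def by (intro sum_nonneg) auto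
    ultimately have "W m = 0" by simp
    then have "\<forall>i\<in>{1..k m}. norm (v m i) powr p = 0"
      unfolding W_def by (subst (asm) sum_nonneg_eq_0_iff) auto
    then have "Z m {1..k m} = rademacher_mean (\<lambda>j. 0 *\<^sub>R v m j) {1..k m} (\<lambda>x. (norm x)\<^sup>2) 0"
      unfolding Z_def by (intro rademacher_mean_cong) auto
    also have "\<dots> = 0" by (subst rademacher_mean_square_scaleR) auto
    finally show False using Z_pos[of m] by simp
  qed
  have k: "k m \<ge> 1" for m using W[of m] by (cases "k m") (auto simp: W_def)
  define w where "w m j = norm (v m j) powr p / W m" for m j
  \<comment> \<open>The reciprocal of \<open>\<delta> m / k m\<close>, the probability of drawing
    one given index of family \<open>m\<close>.\<close>
  define n where "n m = 2 ^ Suc m * k m" for m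
  have n: "n m \<ge> 1" for m using k[of m] by (simp add: n_def)
  have n\<delta>: "real (n m) * \<delta> m = real (k m)" for m by (simp add: n_def \<delta>_def power_one_over field_simps)
  \<comment> \<open>The successor keeps the level positive and at least \<open>k m * w m j\<close>,
    as the lower bound needs. Only thresholds of smaller index lie strictly below
    \<open>a (l m j)\<close>, so their number is still at most \<open>k m * w m j\<close>, as
    summability needs.\<close>
  define l where "l m j = Suc (nat \<lfloor>real (k m) * w m j\<rfloor>)" for m j
  define h where "h = (\<lambda>(m, j). a (l m j) *\<^sub>R sgn (v m j))"
  define \<nu> where "\<nu> = bind_pmf (geometric_pmf (1/2)) (\<lambda>m. map_pmf (Pair m) (pmf_of_set {1..k m}))"
  define \<mu> where "\<mu> = pair_pmf (pmf_of_set (UNIV :: bool set)) \<nu>"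
  define g where "g = (\<lambda>(b, z). if b then h z else - h z)"
  interpret symmetric_index \<mu> "apfst Not" g
    unfolding \<mu>_def g_def by (rule symmetric_index_random_sign)
  have kne: "{1..k m} \<noteq> {}" for m using k[of m] by simp
  have w_nonneg: "w m j \<ge> 0" for m j using W[of m] by (simp add: w_def)
  have prob_snd: "measure_pmf.prob \<mu> {z. Q (snd z)} = measure_pmf.prob \<nu> {z. Q z}" for Q
  proof -
    have "measure_pmf.prob \<nu> {z. Q z} = measure_pmf.prob (map_pmf snd \<mu>) {z. Q z}"
      by (simp add: \<mu>_def map_snd_pair_pmf)
    then show ?thesis by (simp add: vimage_def)
  qed
  \<comment> \<open>By Tonelli the tail sum is the expected number of thresholds below the norm, at
    most the mean of \<open>k m * w m j\<close>. Within each family this mean is 1, because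
    \<open>j\<close> is uniform and the weights add up to 1.\<close>
  have "summable (\<lambda>i. measure_pmf.prob \<mu> {z. norm (g z) > a (Suc i)})"
  proof (rule summable_suminf_not_top)
    have "(\<Sum>i. ennreal (measure_pmf.prob \<mu> {z. norm (g z) > a (Suc i)}))
       = (\<Sum>i. \<integral>\<^sup>+z. indicator {i. a (Suc i) < norm (h z)} i \<partial>measure_pmf \<nu>)"
    proof (rule suminf_cong)
      fix i
      have "norm (g z) = norm (h (snd z))" for z by (simp add: g_def split: prod.split)
      then have "ennreal (measure_pmf.prob \<mu> {z. norm (g z) > a (Suc i)}) = emeasure (measure_pmf \<nu>) {z. a (Suc i) < norm (h z)}"
        using prob_snd[of "\<lambda>z. a (Suc i) < norm (h z)"] by (simp add: measure_pmf.emeasure_eq_measure)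
      also have "\<dots> = (\<integral>\<^sup>+z. indicator {z. a (Suc i) < norm (h z)} z \<partial>measure_pmf \<nu>)" by simp
      finally show "ennreal (measure_pmf.prob \<mu> {z. norm (g z) > a (Suc i)}) =
          (\<integral>\<^sup>+z. indicator {i. a (Suc i) < norm (h z)} i \<partial>measure_pmf \<nu>)"
        by (simp add: indicator_def)
    qed
    also have "\<dots> = (\<integral>\<^sup>+z. (\<Sum>i. indicator {i. a (Suc i) < norm (h z)} i) \<partial>measure_pmf \<nu>)"
      by (rule nn_integral_suminf[symmetric]) simp
    also have "\<dots> \<le> (\<integral>\<^sup>+z. (case z of (m, j) \<Rightarrow> ennreal (real (k m) * w m j)) \<partial>measure_pmf \<nu>)"
    proof (rule nn_integral_mono)
      fix z :: "nat \<times> nat"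
      obtain m j where z: "z = (m, j)" by (cases z)
      have "norm (h z) \<le> a (l m j)"
        using pos[of "l m j"] by (simp add: z h_def norm_sgn l_def)
      then have "(\<Sum>i. indicator {i. a (Suc i) < norm (h z)} i :: ennreal) \<le> of_nat (nat \<lfloor>real (k m) * w m j\<rfloor>)"
        unfolding l_def by (rule suminf_indicator_less_level[OF a])
      also have "\<dots> \<le> ennreal (real (k m) * w m j)"
        using w_nonneg[of m j] by (simp add: ennreal_of_nat_eq_real_of_nat)
      finally show "(\<Sum>i. indicator {i. a (Suc i) < norm (h z)} i) \<le> (case z of (m, j) \<Rightarrow> ennreal (real (k m) * w m j))"
        by (simp add: z)
    qed
    also have "\<dots> = (\<integral>\<^sup>+m. (\<integral>\<^sup>+j. ennreal (real (k m) * w m j) \<partial>measure_pmf (pmf_of_set {1..k m})) \<partial>measure_pmf (geometric_pmf (1/2)))"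
      by (simp add: \<nu>_def nn_integral_bind_pmf)
    also have "\<dots> = (\<integral>\<^sup>+m. 1 \<partial>measure_pmf (geometric_pmf (1/2)))"
    proof (rule nn_integral_cong)
      fix m
      have "(\<integral>\<^sup>+j. ennreal (real (k m) * w m j) \<partial>measure_pmf (pmf_of_set {1..k m})) =
        (\<Sum>j=1..k m. ennreal (real (k m) * w m j)) / of_nat (k m)"
        using kne[of m] by (subst nn_integral_pmf_of_set) auto
      also have "(\<Sum>j=1..k m. ennreal (real (k m) * w m j)) = ennreal (\<Sum>j=1..k m. real (k m) * w m j)"
        using w_nonneg by (intro sum_ennreal) auto
      also have "(\<Sum>j=1..k m. real (k m) * w m j) = real (k m)"
      proof -
        have "(\<Sum>j=1..k m. w m j) = 1"
          unfolding w_def sum_divide_distrib[symmetric] W_def[symmetric] using W[of m] by simp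
        then show ?thesis by (simp only: sum_distrib_left[symmetric] mult_1_right)
      qed
      finally show "(\<integral>\<^sup>+j. ennreal (real (k m) * w m j) \<partial>measure_pmf (pmf_of_set {1..k m})) = 1"
        using k[of m] by (simp add: ennreal_of_nat_eq_real_of_nat divide_ennreal)
    qed
    also have "\<dots> = 1" by simp
    finally show "(\<Sum>i. ennreal (measure_pmf.prob \<mu> {z. norm (g z) > a (Suc i)})) \<noteq> top"
      by (auto simp: top_unique)
  qed simp
  from SLLN_in_probability[OF SLLN pos this]
  have lim: "(\<lambda>n. P.prob {\<omega>\<in>space P. norm (\<Sum>i=1..n. g (\<omega> i)) \<ge> a n}) \<longlonglongrightarrow> 0" .
  \<comment> \<open>1/512 is 1/8, for the hit set having a large mean, times 1/64 from
    Paley-Zygmund.\<close>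
  have lower: "P.prob {\<omega>\<in>space P. norm (\<Sum>i=1..n m. g (\<omega> i)) \<ge> a (n m)} \<ge> 1 / 512" for m
  proof -
    \<comment> \<open>\<open>D j\<close> ignores the sign of the draw; \<open>H \<omega>\<close>
      collects the indices of family \<open>m\<close> hit within the first \<open>n m\<close>
      draws.\<close>
    define D :: "nat \<Rightarrow> (bool \<times> nat \<times> nat) set" where "D j = {z. snd z = (m, j)}" for j
    define H where "H \<omega> = {j\<in>{1..k m}. \<exists>i\<in>{1..n m}. \<omega> i \<in> D j}" for \<omega> :: "nat \<Rightarrow> bool \<times> nat \<times> nat"
    have hit: "{\<omega>\<in>space P. j \<in> H \<omega>} = {\<omega>\<in>space P. \<exists>i\<in>{1..n m}. \<omega> i \<in> D j}" if "j \<in> {1..k m}" for j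
      using that by (auto simp: H_def)
    have prob_D: "measure_pmf.prob \<mu> (D j) = 1 / real (n m)" if j: "j \<in> {1..k m}" for j
    proof -
      have "ennreal (pmf \<nu> (m, j)) = (\<integral>\<^sup>+m'. ennreal (pmf (map_pmf (Pair m') (pmf_of_set {1..k m'})) (m, j)) \<partial>measure_pmf (geometric_pmf (1/2)))"
        unfolding \<nu>_def by (rule ennreal_pmf_bind)
      also have "\<dots> = (\<integral>\<^sup>+m'. ennreal (1 / real (k m)) * indicator {m} m' \<partial>measure_pmf (geometric_pmf (1/2)))"
      proof (intro nn_integral_cong)
        fix m'
        show "ennreal (pmf (map_pmf (Pair m') (pmf_of_set {1..k m'})) (m, j)) = ennreal (1 / real (k m)) * indicator {m} m'"
        proof (cases "m' = m")
          case True
          have "pmf (map_pmf (Pair m) (pmf_of_set {1..k m})) (m, j) = pmf (pmf_of_set {1..k m}) j"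
            by (rule pmf_map_inj') (simp add: inj_on_def)
          then show ?thesis using True j kne[of m] by simp
        next
          case False
          then have "pmf (map_pmf (Pair m') (pmf_of_set {1..k m'})) (m, j) = 0"
            by (subst pmf_eq_0_set_pmf) auto
          then show ?thesis using False by simp
        qed
      qed
      also have "\<dots> = ennreal (1 / real (k m)) * ennreal (\<delta> m)"
        by (subst nn_integral_cmult_indicator) (auto simp: emeasure_pmf_single \<delta>_def)
      also have "\<dots> = ennreal (1 / real (n m))"
        using k[of m] \<delta>[of m] n\<delta>[of m, symmetric] by (subst ennreal_mult[symmetric]) auto
      finally have "pmf \<nu> (m, j) = 1 / real (n m)" by simp
      then show ?thesis
        using prob_snd[of "\<lambda>z. z = (m, j)"] by (simp add: D_def measure_pmf_single)
    qed
    have sub: "H \<omega> \<subseteq> {1..k m}" for \<omega> by (auto simp: H_def)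
    have meas: "{\<omega>\<in>space P. j \<in> H \<omega>} \<in> sets P" if "j \<in> {1..k m}" for j
      unfolding hit[OF that] by (rule hit_measurable)
    have half: "P.prob {\<omega>\<in>space P. j \<in> H \<omega>} \<ge> 1 / 2" if "j \<in> {1..k m}" for j
      unfolding hit[OF that] using n by (intro hit_probability) (simp_all add: prob_D[OF that])
    define E where "E = {\<omega>\<in>space P. Z m (H \<omega>) \<ge> Z m {1..k m} / 8}"
    have E: "E \<in> sets P" "P.prob E \<ge> 1 / 8"
      using P.random_subset_rademacher_mean[OF _ sub meas half, of "v m"] Z_pos[of m]
      unfolding E_def Z_def by auto
    define \<tau> where "\<tau> = (\<delta> m / W m) powr (1 / p) * a (n m)"
    have an: "a (n m) > 0" using pos n by simp
    have "2 * (a (n m))\<^sup>2 \<le> rademacher_mean (\<lambda>i. g (\<omega> i)) {1..n m} (\<lambda>x. (norm x)\<^sup>2) 0" if "\<omega> \<in> E" for \<omega>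
    proof -
      \<comment> \<open>Choose one draw \<open>\<iota> j\<close> for each hit index. Distinct
        indices get distinct draws, since a draw determines its index.\<close>
      have "\<forall>j\<in>H \<omega>. \<exists>i\<in>{1..n m}. snd (\<omega> i) = (m, j)" by (auto simp: H_def D_def)
      then obtain \<iota> where \<iota>: "\<And>j. j \<in> H \<omega> \<Longrightarrow> \<iota> j \<in> {1..n m}" "\<And>j. j \<in> H \<omega> \<Longrightarrow> snd (\<omega> (\<iota> j)) = (m, j)"
        by metis
      have "2 * (a (n m))\<^sup>2 = ((\<delta> m / W m) powr (1 / p))\<^sup>2 * (a (n m))\<^sup>2 * (16 * \<delta> m powr (- (2 / p)) * W m powr (2 / p)) / 8"
      proof -
        have "((\<delta> m / W m) powr (1 / p))\<^sup>2 = \<delta> m powr (2 / p) / W m powr (2 / p)"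
          using \<delta>[of m] W[of m] by (simp add: power2_eq_square powr_add[symmetric] powr_divide)
        then show ?thesis using \<delta>[of m] W[of m] by (simp add: powr_minus field_simps)
      qed
      also have "\<dots> \<le> \<tau>\<^sup>2 * Z m {1..k m} / 8"
        unfolding \<tau>_def power_mult_distrib using Z_large[of m]
        by (intro divide_right_mono mult_left_mono) auto
      also have "\<dots> \<le> \<tau>\<^sup>2 * Z m (H \<omega>)"
        using \<open>\<omega> \<in> E\<close> mult_left_mono[of "Z m {1..k m} / 8" "Z m (H \<omega>)" "\<tau>\<^sup>2"] by (simp add: E_def)
      also have "\<dots> = rademacher_mean (\<lambda>j. \<tau> *\<^sub>R v m j) (H \<omega>) (\<lambda>x. (norm x)\<^sup>2) 0"
        unfolding Z_def using sub by (intro rademacher_mean_square_scaleR[symmetric]) (metis finite_atLeastAtMost finite_subset)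
      also have "\<dots> \<le> rademacher_mean (\<lambda>i. g (\<omega> i)) {1..n m} (\<lambda>x. (norm x)\<^sup>2) 0"
      proof (rule rademacher_mean_dominated)
        show "inj_on \<iota> (H \<omega>)" by (rule inj_onI) (metis \<iota>(2) prod.inject)
        show "\<iota> ` H \<omega> \<subseteq> {1..n m}" using \<iota>(1) by auto
        fix j assume j: "j \<in> H \<omega>"
        \<comment> \<open>The sign of the draw times the ratio of the wanted norm to the actual norm
          \<open>a (l m j)\<close>; for \<open>v m j = 0\<close> both vectors vanish.\<close>
        let ?b = "(if fst (\<omega> (\<iota> j)) then 1 else -1) * (\<tau> * norm (v m j) / a (l m j))"
        have al: "a (l m j) > 0" by (rule pos) (simp add: l_def)
        have \<tau>: "\<tau> \<ge> 0" using an by (simp add: \<tau>_def)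
        have "\<tau> * norm (v m j) \<le> a (l m j)"
          unfolding \<tau>_def
        proof (rule level_dominates[OF p pos mono W \<delta>])
          show "1 \<le> l m j" by (simp add: l_def)
          \<comment> \<open>A single weight is at most 1, so
            \<open>l m j <= k m + 1 <= 2 * k m <= n m\<close>; the power of 2 in \<open>n m\<close>
            absorbs the successor.\<close>
          have "j \<in> {1..k m}" using j sub by blast
          then have "norm (v m j) powr p \<le> W m" unfolding W_def by (intro member_le_sum) auto
          then have "w m j \<le> 1" using W[of m] by (simp add: w_def)
          then have "nat \<lfloor>real (k m) * w m j\<rfloor> \<le> k m"
            using mult_left_mono[of "w m j" 1 "real (k m)"] by linarith
          moreover have "2 * k m \<le> n m" by (simp add: n_def)
          ultimately show "l m j \<le> n m" using k[of m] unfolding l_def by linarith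
          show "real (n m) * \<delta> m * (norm (v m j) powr p / W m) \<le> real (l m j)"
            unfolding n\<delta> w_def[symmetric] l_def by linarith
        qed
        then show "\<bar>?b\<bar> \<le> 1" using al \<tau> by (simp add: abs_mult)
        have "g (\<omega> (\<iota> j)) = (if fst (\<omega> (\<iota> j)) then 1 else -1) *\<^sub>R (a (l m j) *\<^sub>R sgn (v m j))"
          using \<iota>(2)[OF j] by (cases "\<omega> (\<iota> j)") (auto simp: g_def h_def)
        then show "\<tau> *\<^sub>R v m j = ?b *\<^sub>R g (\<omega> (\<iota> j))"
          using al by (cases "v m j = 0") (simp_all add: sgn_div_norm)
      qed (auto simp: convex_on_norm_square)
      finally show ?thesis .
    qed
    then have "P.prob E / 64 \<le> P.prob {\<omega>\<in>space P. norm (\<Sum>i=1..n m. g (\<omega> i)) \<ge> a (n m)}"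
      by (intro measure_sum_large an E(1)) auto
    with E(2) show ?thesis by simp
  qed
  \<comment> \<open>The limit may be taken along the indices \<open>n m\<close>, where
    \<open>lower\<close> contradicts it.\<close>
  have "filterlim n at_top sequentially"
  proof (rule filterlim_at_top_mono[OF filterlim_ident])
    have "m \<le> n m" for m
    proof -
      have "m \<le> 2 ^ Suc m" using less_exp[of "Suc m"] by simp
      also have "\<dots> \<le> n m" using k[of m] by (simp add: n_def)
      finally show ?thesis .
    qed
    then show "eventually (\<lambda>m. m \<le> n m) sequentially" by simp
  qed
  from filterlim_compose[OF lim this]
  have "eventually (\<lambda>m. P.prob {\<omega>\<in>space P. norm (\<Sum>i=1..n m. g (\<omega> i)) \<ge> a (n m)} < 1 / 512) sequentially"
    by (rule order_tendstoD) simp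
  then show False using lower by (auto simp: eventually_sequentially not_less[symmetric])
qed

theorem corollary1p3:
  fixes p :: real and a :: "nat \<Rightarrow> real"
    and N :: "'r measure" and R :: "nat \<Rightarrow> 'r \<Rightarrow> real"
  assumes "1 \<le> p" and "p < 2"
    and "strict_mono_on {1..} a"
    and "\<And>n. n \<ge> 1 \<Longrightarrow> a n > 0"
    and "filterlim a at_top sequentially"
    and "mono_on {1..} (\<lambda>n. real n powr (1 / p) / a n)"
    and "symmetric_SLLN_equivalence a TYPE('b::{banach, second_countable_topology})"
    and "rademacher_seq N R"
  shows "rademacher_type N R p TYPE('b)"
proof -
  have p: "0 < p" "p \<le> 2" using assms(1,2) by auto
  obtain K where "K \<ge> 0" "\<And>(v :: nat \<Rightarrow> 'b) k.
      rademacher_mean v {1..k} (\<lambda>x. (norm x)\<^sup>2) 0 \<le> K * (\<Sum>i=1..k. norm (v i) powr p) powr (2 / p)"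
    using rademacher_mean_bounded_if_SLLN[OF p(1) assms(3,4,6,7)] by auto
  then show ?thesis by (rule rademacher_type_if_square_bound[OF assms(8) p])
qed

end
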